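(* There exist: (1) a $9$-dimensional complex torus $A=V/\Lambda$ (with tangent space $T_{A,0}=V$ and $\Lambda=H_1(A,\mathbb{Z})\subset V$ a lattice) such that the elements $\tau,\sigma\in GL(V)$ are the analytic representations of automorphisms of $A$; the torus $A$ is isomorphic to the Abelian variety $E^{9}$, where $E$ is the elliptic curve $\mathbb{C}/\mathbb{Z}[\nu]$, $\nu=\frac{-1+i\sqrt{19}}{2}$; (2) a unique principal polarization $\Theta$ on $A$ which is invariant under the automorphisms $\sigma,\tau$. The period lattice of $A$ is then $$H_{1}(A,\mathbb{Z})=\mathbb{Z}[\nu]w_{0}'+\mathbb{Z}[\nu]w_{1}'+\mathbb{Z}[\nu]w_{2}'+\mathbb{Z}[\nu]w_{3}'+\bigoplus_{k=4}^{8}\mathbb{Z}[\nu]v_{k},$$ and $$c_{1}(\Theta)=\frac{i}{\sqrt{19}}\sum_{k=1}^{9}dx_{k}\wedge d\bar{x}_{k},$$ where $x_{1},\dots,x_{9}$ is the dual basis of $e_1,\dots,e_9$.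
   Context: Let $V$ be a $9$-dimensional complex vector space with basis $e_1,\dots,e_9$, and let $\xi=e^{2i\pi/19}$. Let $\tau\in GL(V)$ be the order $19$ automorphism $\tau(e_j)=\xi^{j^2}e_j$, and $\sigma\in GL(V)$ the order $9$ automorphism $\sigma(e_j)=e_{|6j|}$, where for an integer $t$, $|t|$ denotes the unique integer $0\le u\le 9$ with $t\equiv\pm u \bmod 19$. Put $$\nu=\sum_{k=1}^{9}\xi^{k^2}=\frac{-1+i\sqrt{19}}{2},\qquad v_k=\tau^k(e_1+\dots+e_9)=\sum_{j=1}^9\xi^{kj^2}e_j\quad(k\in\mathbb{Z}/19\mathbb{Z}),$$ $$w_k'=\frac{1}{1+2\nu}\left(v_k-5v_{k+1}+10v_{k+2}-10v_{k+3}+5v_{k+4}-v_{k+5}\right).$$ The analytic representation of an endomorphism $h$ of a torus $A$ is its differential $dh$ acting on $T_{A,0}$. The class $c_1(\Theta)$ is the first Chern class, represented by the translation-invariant $(1,1)$-form $\frac{i}{2}\sum_{j,k}H_{jk}\,dx_j\wedge d\bar{x}_k$, where $(H_{jk})$ is the matrix of the positive definite Hermitian form of $\Theta$ (whose imaginary part is integer valued on $H_1(A,\mathbb{Z})$). *)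

theory Defs
  imports "HOL-Analysis.Analysis" "HOL-Algebra.Coset" "HOL-Computational_Algebra.Polynomial"
begin

section \<open>Complex tori\<close>

definition is_lattice :: "'a::euclidean_space set \<Rightarrow> bool" where
  "is_lattice \<Lambda> \<longleftrightarrow> (\<exists>B. independent B \<and> span B = UNIV \<and>
     \<Lambda> = {(\<Sum>b\<in>B. of_int (c b) *\<^sub>R b) | c :: 'a \<Rightarrow> int. True})"

definition additive_group :: "'a::ab_group_add monoid" where
  "additive_group = \<lparr>carrier = UNIV, monoid.mult = (+), one = 0\<rparr>"

definition torus :: "'a::ab_group_add set \<Rightarrow> 'a set monoid" where
  "torus \<Lambda> = additive_group Mod \<Lambda>"

definition torus_proj :: "'a::ab_group_add set \<Rightarrow> 'a \<Rightarrow> 'a set" where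
  "torus_proj \<Lambda> x = \<Lambda> #>\<^bsub>additive_group\<^esub> x"

text \<open>
  The projection from the vector space to the torus is a holomorphic covering whose local inverses
  are the charts of the torus. Hence a map between tori is holomorphic iff near every point it is
  induced by a holomorphic map between open subsets of the vector spaces, and the derivative of
  such a local lift at 0 is the differential of the map at the origin, whichever lift is taken.
\<close>

definition holomorphic_lift ::
  "(complex^'n) set \<Rightarrow> (complex^'m) set \<Rightarrow> ((complex^'n) set \<Rightarrow> (complex^'m) set)
    \<Rightarrow> (complex^'n) set \<Rightarrow> (complex^'n \<Rightarrow> complex^'m) \<Rightarrow> bool" where
  "holomorphic_lift \<Lambda> \<Gamma> h U g \<longleftrightarrow> open U \<and>
     (\<forall>y\<in>U. h (torus_proj \<Lambda> y) = torus_proj \<Gamma> (g y)) \<and>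
     (\<forall>y\<in>U. \<exists>D. Vector_Spaces.linear (*s) (*s) D \<and> (g has_derivative D) (at y))"

definition torus_holomorphic ::
  "(complex^'n) set \<Rightarrow> (complex^'m) set \<Rightarrow> ((complex^'n) set \<Rightarrow> (complex^'m) set) \<Rightarrow> bool" where
  "torus_holomorphic \<Lambda> \<Gamma> h \<longleftrightarrow> (\<forall>x. \<exists>U g. x \<in> U \<and> holomorphic_lift \<Lambda> \<Gamma> h U g)"

definition torus_iso ::
  "(complex^'n) set \<Rightarrow> (complex^'m) set \<Rightarrow> ((complex^'n) set \<Rightarrow> (complex^'m) set) \<Rightarrow> bool" where
  "torus_iso \<Lambda> \<Gamma> h \<longleftrightarrow> h \<in> iso (torus \<Lambda>) (torus \<Gamma>) \<and> torus_holomorphic \<Lambda> \<Gamma> h \<and>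
     torus_holomorphic \<Gamma> \<Lambda> (inv_into (carrier (torus \<Lambda>)) h)"

abbreviation torus_automorphism ::
  "(complex^'n) set \<Rightarrow> ((complex^'n) set \<Rightarrow> (complex^'n) set) \<Rightarrow> bool" where
  "torus_automorphism \<Lambda> h \<equiv> torus_iso \<Lambda> \<Lambda> h"

definition analytic_representation ::
  "(complex^'n) set \<Rightarrow> (complex^'m) set \<Rightarrow> ((complex^'n) set \<Rightarrow> (complex^'m) set)
    \<Rightarrow> (complex^'n \<Rightarrow> complex^'m) \<Rightarrow> bool" where
  "analytic_representation \<Lambda> \<Gamma> h L \<longleftrightarrow>
     (\<exists>U g. 0 \<in> U \<and> holomorphic_lift \<Lambda> \<Gamma> h U g \<and> (g has_derivative L) (at 0))"

text \<open>The product of \<open>n\<close> copies of \<open>\<complex>/\<Gamma>\<close> is the quotient of \<open>\<complex>\<^sup>n\<close> by this lattice.\<close>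

definition lattice_power :: "complex set \<Rightarrow> (complex^'n) set" where
  "lattice_power \<Gamma> = {z. \<forall>i. z $ i \<in> \<Gamma>}"

text \<open>The ring \<open>\<int>[z]\<close>.\<close>

definition int_adjoin :: "complex \<Rightarrow> complex set" where
  "int_adjoin z = {poly (map_poly of_int p) z | p :: int poly. True}"


section \<open>Polarizations\<close>

text \<open>Hermitian forms are linear in the first and conjugate-linear in the second argument.\<close>

definition hermitian_form :: "(complex^'n \<Rightarrow> complex^'n \<Rightarrow> complex) \<Rightarrow> bool" where
  "hermitian_form H \<longleftrightarrow> (\<forall>v. Vector_Spaces.linear (*s) (*) (\<lambda>u. H u v)) \<and>
     (\<forall>u v. H v u = cnj (H u v))"

definition polarization ::
  "(complex^'n) set \<Rightarrow> (complex^'n \<Rightarrow> complex^'n \<Rightarrow> complex) \<Rightarrow> bool" where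
  "polarization \<Lambda> H \<longleftrightarrow> hermitian_form H \<and> (\<forall>u. u \<noteq> 0 \<longrightarrow> Re (H u u) > 0) \<and>
     (\<forall>l\<in>\<Lambda>. \<forall>m\<in>\<Lambda>. Im (H l m) \<in> \<int>)"

text \<open>
  The kernel of the isogeny from the torus to its dual given by \<open>H\<close> is
  \<open>{u. \<forall>l\<in>\<Lambda>. Im (H u l) \<in> \<int>} / \<Lambda>\<close>; the polarization is principal iff this isogeny is an isomorphism.
\<close>

definition principal_polarization ::
  "(complex^'n) set \<Rightarrow> (complex^'n \<Rightarrow> complex^'n \<Rightarrow> complex) \<Rightarrow> bool" where
  "principal_polarization \<Lambda> H \<longleftrightarrow> polarization \<Lambda> H \<and> {u. \<forall>l\<in>\<Lambda>. Im (H u l) \<in> \<int>} = \<Lambda>"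

text \<open>
  The pullback of a polarization by an endomorphism with analytic representation \<open>L\<close>
  is the pullback of its Hermitian form by \<open>L\<close>.
\<close>

definition form_pullback ::
  "('a \<Rightarrow> 'b) \<Rightarrow> ('b \<Rightarrow> 'b \<Rightarrow> complex) \<Rightarrow> 'a \<Rightarrow> 'a \<Rightarrow> complex" where
  "form_pullback L H = (\<lambda>u v. H (L u) (L v))"


section \<open>The vector space \<open>V\<close> and its automorphisms\<close>

text \<open>
  The index type \<open>9\<close> is the ring of integers modulo 9, so that \<open>of_nat\<close> maps \<open>{1..9}\<close>
  bijectively onto it (with \<open>of_nat 9 = 0\<close>).
\<close>

type_synonym V = "complex^9"

definition ebasis :: "nat \<Rightarrow> V" where
  "ebasis j = axis (of_nat j) 1"

definition coord :: "nat \<Rightarrow> V \<Rightarrow> complex" where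
  "coord j u = u $ of_nat j"

definition xi :: complex where
  "xi = exp (2 * \<i> * of_real pi / 19)"

definition nu :: complex where
  "nu = (\<Sum>k=1..9. xi ^ (k\<^sup>2))"

definition res19 :: "int \<Rightarrow> nat" where
  "res19 t = (THE u. u \<le> 9 \<and> (t mod 19 = int u mod 19 \<or> t mod 19 = (- int u) mod 19))"

definition tau_map :: "V \<Rightarrow> V" where
  "tau_map u = (\<Sum>j=1..9. coord j u *s (xi ^ (j\<^sup>2) *s ebasis j))"

definition sigma_map :: "V \<Rightarrow> V" where
  "sigma_map u = (\<Sum>j=1..9. coord j u *s ebasis (res19 (6 * int j)))"

definition vvec :: "nat \<Rightarrow> V" where
  "vvec k = (tau_map ^^ k) (\<Sum>j=1..9. ebasis j)"

definition wvec :: "nat \<Rightarrow> V" where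
  "wvec k = (1 / (1 + 2 * nu)) *s (vvec k - 5 *s vvec (k + 1) + 10 *s vvec (k + 2)
      - 10 *s vvec (k + 3) + 5 *s vvec (k + 4) - vvec (k + 5))"


section \<open>Translation-invariant 2-forms\<close>

text \<open>
  A class in \<open>H\<^sup>2(A, \<complex>)\<close> contains exactly one translation-invariant form, i.e. one alternating
  \<open>\<real>\<close>-bilinear form on \<open>V\<close>. In particular the first Chern class of a polarization is identified
  with the form \<open>first_chern H\<close>.
\<close>

definition wedge :: "('a \<Rightarrow> complex) \<Rightarrow> ('a \<Rightarrow> complex) \<Rightarrow> 'a \<Rightarrow> 'a \<Rightarrow> complex" where
  "wedge \<alpha> \<beta> = (\<lambda>u v. \<alpha> u * \<beta> v - \<alpha> v * \<beta> u)"

definition dx :: "nat \<Rightarrow> V \<Rightarrow> complex" where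
  "dx k = coord k"

definition dxbar :: "nat \<Rightarrow> V \<Rightarrow> complex" where
  "dxbar k = (\<lambda>u. cnj (coord k u))"

definition first_chern :: "(V \<Rightarrow> V \<Rightarrow> complex) \<Rightarrow> V \<Rightarrow> V \<Rightarrow> complex" where
  "first_chern H = (\<lambda>u v. \<i> / 2 *
     (\<Sum>j=1..9. \<Sum>k=1..9. H (ebasis j) (ebasis k) * wedge (dx j) (dxbar k) u v))"

end

theory Submission
  imports Defs "HOL-Number_Theory.Cong"
begin

text \<open>
  Evaluating polynomials in \<open>\<xi>\<close> at the conjugates \<open>\<xi>\<^sup>q\<close>, \<open>q = j\<^sup>2\<close>, embeds \<open>\<int>[\<xi>]\<close> in \<open>V\<close>, with
  \<open>v\<^sub>k\<close> the image of \<open>\<xi>\<^sup>k\<close>, \<open>\<tau>\<close> multiplication by \<open>\<xi>\<close> and \<open>\<sigma>\<close> the Galois automorphism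
  \<open>\<xi> \<mapsto> \<xi>\<^sup>9\<close>. The lattice is the fractional ideal generated by \<open>(1 - \<xi>)\<^sup>5 / \<surd>-19\<close>. As \<open>\<surd>-19\<close> is
  \<open>(1 - \<xi>)\<^sup>9\<close> times a unit, this ideal is \<open>(1 - \<xi>)\<^sup>-\<^sup>4\<close>, which is its own dual for the Hermitian
  trace form with values in \<open>\<int>[\<nu>]\<close>; this gives the principal polarization. A
  \<open>\<tau>\<close>-invariant form is diagonal because the eigenvalues of \<open>\<tau>\<close> are distinct, a \<open>\<sigma>\<close>-invariant
  diagonal form is scalar because \<open>\<sigma>\<close> permutes the basis transitively, and the scalar is
  determined because two principal polarizations in ratio \<open>r\<close> satisfy \<open>r \<Lambda> = \<Lambda>\<close>.
\<close>

section \<open>Linear maps between complex tori\<close>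

lemma scaleR_eq_vector_mult: "r *\<^sub>R x = complex_of_real r *s x" for x :: "complex^'n"
  by (simp add: vec_eq_iff scaleR_conv_of_real[where 'a=complex])

lemma complex_linear_bounded_linear:
  fixes L :: "complex^'n \<Rightarrow> complex^'m"
  assumes "Vector_Spaces.linear (*s) (*s) L"
  shows "bounded_linear L"
proof -
  interpret L: Vector_Spaces.linear "(*s)" "(*s)" L by fact
  have "linear L"
    by (rule linearI) (simp_all add: L.add L.scale scaleR_eq_vector_mult)
  then show ?thesis
    by (simp add: linear_conv_bounded_linear)
qed

lemma complex_linear_inv:
  fixes L :: "complex^'n \<Rightarrow> complex^'m"
  assumes lin: "Vector_Spaces.linear (*s) (*s) L" and "bij L"
  shows "Vector_Spaces.linear (*s) (*s) (inv_into UNIV L)"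
proof -
  interpret L: Vector_Spaces.linear "(*s)" "(*s)" L by fact
  have i: "inj L" and s: "surj L" using \<open>bij L\<close> by (auto simp: bij_def)
  show ?thesis
  proof (unfold_locales)
    show "inv_into UNIV L (x + y) = inv_into UNIV L x + inv_into UNIV L y" for x y
      by (rule inv_f_eq[OF i]) (simp add: L.add surj_f_inv_f[OF s])
    show "inv_into UNIV L (c *s x) = c *s inv_into UNIV L x" for c x
      by (rule inv_f_eq[OF i]) (simp add: L.scale surj_f_inv_f[OF s])
  qed
qed

definition add_subgroup :: "'a::ab_group_add set \<Rightarrow> bool" where
  "add_subgroup \<Lambda> \<longleftrightarrow> 0 \<in> \<Lambda> \<and> (\<forall>x\<in>\<Lambda>. \<forall>y\<in>\<Lambda>. x - y \<in> \<Lambda>)"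

lemma add_subgroup_add:
  assumes "add_subgroup \<Lambda>" "x \<in> \<Lambda>" "y \<in> \<Lambda>" shows "x + y \<in> \<Lambda>"
proof -
  have "x - (0 - y) \<in> \<Lambda>" using assms unfolding add_subgroup_def by blast
  then show ?thesis by simp
qed

lemma torus_proj_eq_image: "torus_proj \<Lambda> x = (\<lambda>l. l + x) ` \<Lambda>"
  by (auto simp: torus_proj_def r_coset_def additive_group_def)

lemma carrier_torus: "carrier (torus \<Lambda>) = range (torus_proj \<Lambda>)"
  by (auto simp: torus_def FactGroup_def RCOSETS_def torus_proj_def additive_group_def)

lemma torus_mult_proj:
  assumes "add_subgroup \<Lambda>"
  shows "torus_proj \<Lambda> x \<otimes>\<^bsub>torus \<Lambda>\<^esub> torus_proj \<Lambda> y = torus_proj \<Lambda> (x + y)"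
proof -
  have "\<exists>h\<in>\<Lambda>. \<exists>k\<in>\<Lambda>. l + (x + y) = h + x + (k + y)" if "l \<in> \<Lambda>" for l
    by (rule bexI[OF _ that], rule bexI[of _ 0]) (use assms in \<open>auto simp: add_subgroup_def\<close>)
  moreover have "h + x + (k + y) \<in> (\<lambda>l. l + (x + y)) ` \<Lambda>" if "h \<in> \<Lambda>" "k \<in> \<Lambda>" for h k
    by (rule image_eqI[of _ _ "h + k"]) (use add_subgroup_add[OF assms that] in auto)
  ultimately show ?thesis
    by (auto simp: torus_def FactGroup_def set_mult_def torus_proj_eq_image additive_group_def)
qed

lemma holomorphic_lift_linear:
  assumes "Vector_Spaces.linear (*s) (*s) L" "\<And>x. h (torus_proj \<Lambda> x) = torus_proj \<Gamma> (L x)"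
  shows "holomorphic_lift \<Lambda> \<Gamma> h UNIV L"
  using assms complex_linear_bounded_linear[OF assms(1)]
  by (auto simp: holomorphic_lift_def intro: bounded_linear_imp_has_derivative)

text \<open>Torus elements are cosets, so taking images under \<open>L\<close> is the induced map on
  quotients. \<open>L\<close> is a global lift of this map and the inverse of \<open>L\<close> a
  global lift of its inverse, whence both are holomorphic.\<close>

lemma torus_iso_linear:
  fixes L :: "complex^'n \<Rightarrow> complex^'m"
  assumes lin: "Vector_Spaces.linear (*s) (*s) L" and "bij L"
    and sub: "add_subgroup \<Lambda>" and im: "L ` \<Lambda> = \<Gamma>"
  shows "torus_iso \<Lambda> \<Gamma> ((`) L)" "analytic_representation \<Lambda> \<Gamma> ((`) L) L"
proof -
  interpret L: Vector_Spaces.linear "(*s)" "(*s)" L by fact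
  have i: "inj L" and s: "surj L" using \<open>bij L\<close> by (auto simp: bij_def)
  have sub': "add_subgroup \<Gamma>"
    unfolding add_subgroup_def im[symmetric]
  proof (intro conjI ballI)
    show "0 \<in> L ` \<Lambda>"
      by (rule image_eqI[of _ _ 0]) (use sub L.zero in \<open>auto simp: add_subgroup_def\<close>)
    fix x y assume "x \<in> L ` \<Lambda>" "y \<in> L ` \<Lambda>"
    then obtain x' y' where "x = L x'" "y = L y'" "x' \<in> \<Lambda>" "y' \<in> \<Lambda>" by blast
    then show "x - y \<in> L ` \<Lambda>"
      using sub by (intro image_eqI[of _ _ "x' - y'"]) (auto simp: add_subgroup_def L.diff)
  qed
  have proj: "L ` torus_proj \<Lambda> x = torus_proj \<Gamma> (L x)" for x
    by (simp add: torus_proj_eq_image image_image L.add flip: im)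
  have inj': "inj_on ((`) L) (carrier (torus \<Lambda>))"
    using i by (meson inj_image_eq_iff inj_onI)
  have inv_proj: "inv_into (carrier (torus \<Lambda>)) ((`) L) (torus_proj \<Gamma> y) = torus_proj \<Lambda> (inv_into UNIV L y)" for y
    by (rule inv_into_f_eq[OF inj']) (auto simp: carrier_torus proj surj_f_inv_f[OF s])
  have "bij_betw ((`) L) (carrier (torus \<Lambda>)) (carrier (torus \<Gamma>))"
    unfolding bij_betw_def
  proof (intro conjI inj')
    have "(`) L ` range (torus_proj \<Lambda>) = torus_proj \<Gamma> ` range L"
      by (simp add: image_image proj)
    then show "(`) L ` carrier (torus \<Lambda>) = carrier (torus \<Gamma>)" using s by (simp add: carrier_torus)
  qed
  moreover have "(`) L \<in> hom (torus \<Lambda>) (torus \<Gamma>)"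
  proof (rule homI)
    show "L ` X \<in> carrier (torus \<Gamma>)" if "X \<in> carrier (torus \<Lambda>)" for X
      using that proj by (auto simp: carrier_torus)
    fix X Y assume "X \<in> carrier (torus \<Lambda>)" "Y \<in> carrier (torus \<Lambda>)"
    then obtain x y where X: "X = torus_proj \<Lambda> x" and Y: "Y = torus_proj \<Lambda> y"
      unfolding carrier_torus by blast
    show "L ` (X \<otimes>\<^bsub>torus \<Lambda>\<^esub> Y) = L ` X \<otimes>\<^bsub>torus \<Gamma>\<^esub> L ` Y"
      unfolding X Y torus_mult_proj[OF sub] proj torus_mult_proj[OF sub'] L.add ..
  qed
  moreover have "torus_holomorphic \<Lambda> \<Gamma> ((`) L)"
    using holomorphic_lift_linear[OF lin, of "(`) L" \<Lambda> \<Gamma>] proj unfolding torus_holomorphic_def by blast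
  moreover have "torus_holomorphic \<Gamma> \<Lambda> (inv_into (carrier (torus \<Lambda>)) ((`) L))"
    using holomorphic_lift_linear[OF complex_linear_inv[OF lin \<open>bij L\<close>],
        of "inv_into (carrier (torus \<Lambda>)) ((`) L)" \<Gamma> \<Lambda>] inv_proj
    unfolding torus_holomorphic_def by blast
  ultimately show "torus_iso \<Lambda> \<Gamma> ((`) L)" by (simp add: torus_iso_def iso_def)
  show "analytic_representation \<Lambda> \<Gamma> ((`) L) L"
    unfolding analytic_representation_def
    using holomorphic_lift_linear[OF lin, of "(`) L" \<Lambda> \<Gamma>] proj
      bounded_linear_imp_has_derivative[OF complex_linear_bounded_linear[OF lin]] by blast
qed

section \<open>Lattices: linear images and the model \<open>lattice_power\<close>\<close>

lemma is_lattice_linear_image: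
  fixes L :: "'a::euclidean_space \<Rightarrow> 'b::euclidean_space"
  assumes "is_lattice \<Lambda>" "linear L" "bij L"
  shows "is_lattice (L ` \<Lambda>)"
proof -
  from assms(1) obtain B where B: "independent B" "span B = UNIV"
    and \<Lambda>: "\<Lambda> = {(\<Sum>b\<in>B. of_int (c b) *\<^sub>R b) | c :: 'a \<Rightarrow> int. True}"
    unfolding is_lattice_def by blast
  have i: "inj L" and s: "surj L" using \<open>bij L\<close> by (auto simp: bij_def)
  have sum_im: "(\<Sum>b\<in>L ` B. of_int (c b) *\<^sub>R b) = L (\<Sum>b\<in>B. of_int (c (L b)) *\<^sub>R b)" for c :: "'b \<Rightarrow> int"
    using i by (subst sum.reindex)
      (auto simp: linear_sum[OF assms(2)] linear_scale[OF assms(2)] inj_on_def)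
  have "L ` \<Lambda> = {(\<Sum>b\<in>L ` B. of_int (c b) *\<^sub>R b) | c :: 'b \<Rightarrow> int. True}"
  proof (intro equalityI subsetI)
    fix y assume "y \<in> L ` \<Lambda>"
    then obtain c :: "'a \<Rightarrow> int" where "y = L (\<Sum>b\<in>B. of_int (c b) *\<^sub>R b)" by (auto simp: \<Lambda>)
    then have "y = (\<Sum>b\<in>L ` B. of_int ((c \<circ> inv_into UNIV L) b) *\<^sub>R b)" using i sum_im[of "c \<circ> inv_into UNIV L"] by simp
    then show "y \<in> {(\<Sum>b\<in>L ` B. of_int (c b) *\<^sub>R b) | c :: 'b \<Rightarrow> int. True}" by blast
  next
    fix y assume "y \<in> {(\<Sum>b\<in>L ` B. of_int (c b) *\<^sub>R b) | c :: 'b \<Rightarrow> int. True}"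
    then obtain c :: "'b \<Rightarrow> int" where "y = L (\<Sum>b\<in>B. of_int (c (L b)) *\<^sub>R b)"
      using sum_im by blast
    moreover have "(\<Sum>b\<in>B. of_int (c (L b)) *\<^sub>R b) \<in> \<Lambda>"
      unfolding \<Lambda> by (intro CollectI exI[of _ "\<lambda>b. c (L b)"]) simp
    ultimately show "y \<in> L ` \<Lambda>" by blast
  qed
  moreover have "independent (L ` B)"
    using linear_independent_injective_image[OF assms(2) B(1)] inj_on_subset[OF i] by blast
  moreover have "span (L ` B) = UNIV"
    using span_linear_image[OF assms(2)] B(2) s by metis
  ultimately show ?thesis unfolding is_lattice_def by blast
qed

lemma is_lattice_lattice_power:
  assumes "Im z \<noteq> 0"
  shows "is_lattice (lattice_power {of_int a + of_int b * z | a b :: int. True} :: (complex^'n) set)"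
proof -
  define B1 :: "(complex^'n) set" where "B1 = range (\<lambda>i. axis i 1)"
  define B2 :: "(complex^'n) set" where "B2 = range (\<lambda>i. axis i z)"
  have z: "z \<noteq> 0" "z \<noteq> 1" using assms by auto
  have inj1: "inj (\<lambda>i::'n. axis i (1::complex))" and inj2: "inj (\<lambda>i::'n. axis i z)"
    using z by (auto simp: inj_def axis_eq_axis)
  have disj: "B1 \<inter> B2 = {}" using z by (auto simp: B1_def B2_def axis_eq_axis)
  have fin: "finite B1" "finite B2" by (auto simp: B1_def B2_def)
  have sum_B: "(\<Sum>b\<in>B1 \<union> B2. of_real (f b) *s b)
      = (\<chi> i. of_real (f (axis i 1)) + of_real (f (axis i z)) * z)" for f :: "complex^'n \<Rightarrow> real"
  proof -
    have "(\<Sum>b\<in>B1 \<union> B2. of_real (f b) *s b)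
        = (\<Sum>i\<in>UNIV. of_real (f (axis i 1)) *s axis i 1) + (\<Sum>i\<in>UNIV. of_real (f (axis i z)) *s axis i z)"
      by (subst sum.union_disjoint[OF fin disj]) (simp add: B1_def B2_def sum.reindex[OF inj1] sum.reindex[OF inj2])
    also have "\<dots> = (\<chi> i. of_real (f (axis i 1)) + of_real (f (axis i z)) * z)"
      by (simp add: vec_eq_iff axis_def if_distrib[where f = "(*) _"] cong: if_cong)
    finally show ?thesis .
  qed
  have span: "span (B1 \<union> B2) = UNIV"
  proof -
    have "x \<in> span (B1 \<union> B2)" for x
    proof -
      define b where "b i = Im (x $ i) / Im z" for i
      define a where "a i = Re (x $ i) - b i * Re z" for i
      have "x $ i = of_real (a i) + of_real (b i) * z" for i
        using assms by (simp add: complex_eq_iff a_def b_def)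
      then have "x = (\<Sum>i\<in>UNIV. a i *\<^sub>R axis i 1 + b i *\<^sub>R axis i z)"
        by (simp add: vec_eq_iff axis_def if_distrib sum.distrib scaleR_conv_of_real[where 'a=complex] cong: if_cong)
      also have "\<dots> \<in> span (B1 \<union> B2)"
        by (intro span_sum span_add span_scale span_base) (auto simp: B1_def B2_def)
      finally show ?thesis .
    qed
    then show ?thesis by blast
  qed
  \<comment> \<open>Independence by counting: a spanning set with at most twice
    \<open>CARD('n)\<close> elements, in a real space of exactly that dimension, is a basis.\<close>
  have "card (B1 \<union> B2) \<le> CARD('n) + CARD('n)"
    using card_Un_le[of B1 B2] card_image_le[of UNIV "\<lambda>i::'n. axis i (1::complex)"]
      card_image_le[of UNIV "\<lambda>i::'n. axis i z"] by (simp add: B1_def B2_def)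
  then have ind: "independent (B1 \<union> B2)"
    using card_le_dim_spanning[of "B1 \<union> B2" UNIV] span fin by (simp add: dim_UNIV)
  have "lattice_power {of_int a + of_int b * z | a b :: int. True}
     = {(\<Sum>b\<in>B1 \<union> B2. of_int (c b) *\<^sub>R b) | c. True}" (is "?l = ?r")
  proof (intro equalityI subsetI)
    fix x assume "x \<in> ?l"
    then have "\<forall>i. \<exists>a b::int. x $ i = of_int a + of_int b * z" by (auto simp: lattice_power_def)
    then obtain a b :: "'n \<Rightarrow> int" where ab: "\<And>i. x $ i = of_int (a i) + of_int (b i) * z" by metis
    define c where "c v = (if v \<in> B1 then a (inv_into UNIV (\<lambda>i. axis i 1) v) else b (inv_into UNIV (\<lambda>i. axis i z) v))" for v
    have "axis i z \<notin> B1" "axis i 1 \<in> B1" for i using disj by (auto simp: B1_def B2_def)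
    then have "c (axis i 1) = a i" "c (axis i z) = b i" for i
      using inv_f_f[OF inj1] inv_f_f[OF inj2] by (simp_all add: c_def)
    then have "x = (\<Sum>v\<in>B1 \<union> B2. of_int (c v) *\<^sub>R v)"
      using sum_B[of "\<lambda>b. of_int (c b)"] ab by (simp add: scaleR_eq_vector_mult vec_eq_iff)
    then show "x \<in> ?r" by blast
  next
    fix x assume "x \<in> ?r"
    then obtain c :: "complex^'n \<Rightarrow> int" where "x = (\<Sum>b\<in>B1 \<union> B2. of_int (c b) *\<^sub>R b)" by blast
    then have "x = (\<chi> i. of_int (c (axis i 1)) + of_int (c (axis i z)) * z)"
      using sum_B[of "\<lambda>b. of_int (c b)"] by (simp add: scaleR_eq_vector_mult)
    then show "x \<in> ?l" by (auto simp: lattice_power_def)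
  qed
  then show ?thesis unfolding is_lattice_def using ind span by blast
qed

section \<open>Quadratic Gauss periods modulo 19\<close>

abbreviation QR19 :: "nat set" where
  "QR19 \<equiv> {1, 4, 5, 6, 7, 9, 11, 16, 17}"

definition gauss_period :: "complex \<Rightarrow> complex" where
  "gauss_period z = (\<Sum>q\<in>QR19. z ^ q)"

lemma gauss_period_expand:
  "gauss_period z = z + z^4 + z^5 + z^6 + z^7 + z^9 + z^11 + z^16 + z^17"
  by (simp add: gauss_period_def)

lemma cyclotomic_19:
  fixes z :: complex
  assumes "z ^ 19 = 1" "z \<noteq> 1"
  shows "1+z+z^2+z^3+z^4+z^5+z^6+z^7+z^8+z^9+z^10+z^11+z^12+z^13+z^14+z^15+z^16+z^17+z^18 = 0"
proof -
  have "(\<Sum>k<19. z ^ k) = 0" using geometric_sum[OF assms(2), of 19] assms(1) by simp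
  then show ?thesis by (simp add: eval_nat_numeral lessThan_Suc algebra_simps)
qed

lemma power_mod_19:
  fixes z :: "'a::monoid_mult"
  assumes "z ^ 19 = 1" shows "z ^ (n mod 19) = z ^ n"
proof -
  have "z ^ n = z ^ (19 * (n div 19) + n mod 19)" by simp
  also have "\<dots> = z ^ (n mod 19)" by (simp only: power_add power_mult assms power_one mult_1)
  finally show ?thesis by simp
qed

text \<open>The two periods are conjugate over \<rat> with sum -1 and product 5. The relation is
  verified as a polynomial identity modulo the cyclotomic relation.\<close>

lemma gauss_period_quadratic:
  assumes "z ^ 19 = 1" "z \<noteq> 1"
  shows "(gauss_period z)\<^sup>2 = - gauss_period z - 5"
  using cyclotomic_19[OF assms] unfolding gauss_period_expand by algebra

text \<open>The coefficients come from expanding the product of the \<open>X - \<xi>\<^sup>q\<close> over the quadratic residues \<open>q\<close>.\<close>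

lemma gauss_period_minpoly:
  assumes "z ^ 19 = 1" "z \<noteq> 1" and n: "n = gauss_period z"
  shows "z^9 = 1 + (1+n)*z - 2*z^2 + (1-n)*z^3 + (3+n)*z^4 + (-2+n)*z^5 + (-2-n)*z^6 + 2*z^7 + n*z^8"
  using cyclotomic_19[OF assms(1,2)] unfolding n gauss_period_expand by algebra

text \<open>The degree 9 equation of z over \<int>[n] reduces (1 - z)^9 to degree at most 8, and all
  resulting coefficients turn out to be divisible by 1 + 2n, a square root of -19.\<close>

lemma ramification:
  assumes "z ^ 19 = 1" "z \<noteq> 1" and n: "n = gauss_period z"
  shows "(1-z)^9 = (1+2*n) * (n*z + (-2-4*n)*z^2 + (5+9*n)*z^3 + (-7-13*n)*z^4
           + (6+13*n)*z^5 + (-4-9*n)*z^6 + (2+4*n)*z^7 + (-1-n)*z^8)"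
  using gauss_period_quadratic[OF assms(1,2)] gauss_period_minpoly[OF assms]
  unfolding n[symmetric] by algebra

text \<open>
  The cofactor is the quotient of \<open>1 + 2n\<close> by \<open>(1 - z)\<^sup>9\<close> in \<open>\<rat>(z)\<close>; that it has integer coefficients
  means that \<open>\<surd>-19\<close> and \<open>(1 - z)\<^sup>9\<close> differ by a unit.
\<close>

lemma ramification_inverse:
  assumes "z ^ 19 = 1" "z \<noteq> 1" and n: "n = gauss_period z"
  shows "1 + 2*n = (1-z)^9 * (3219 + 6538*z + 9596*z^2 + 12058*z^3 + 13653*z^4 + 14205*z^5
           + 13653*z^6 + 12058*z^7 + 9596*z^8 + 6538*z^9 + 3219*z^10 - 2772*z^12 - 4801*z^13
           - 5872*z^14 - 5872*z^15 - 4801*z^16 - 2772*z^17)"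
  using cyclotomic_19[OF assms(1,2)] unfolding n gauss_period_expand by algebra

text \<open>A unit modulo 19 acts injectively on representatives below 19; equal cardinalities then
  give surjectivity.\<close>

lemma mult_mod_19_bij:
  fixes A B :: "nat set"
  assumes "\<not> 19 dvd r" "A \<subseteq> {..<19}" "\<And>q. q \<in> A \<Longrightarrow> r * q mod 19 \<in> B" "finite B" "card A = card B"
  shows "bij_betw (\<lambda>q. r * q mod 19) A B"
proof -
  have "prime (19::nat)" by simp
  then have "coprime r 19" using assms(1) prime_imp_coprime[of 19 r] by (simp add: coprime_commute)
  then have inj: "inj_on (\<lambda>q. r * q mod 19) A"
    using assms(2)
    by (auto simp: inj_on_def subset_iff cong_mult_lcancel_nat simp flip: cong_def
        intro: cong_less_modulus_unique_nat)
  moreover have "(\<lambda>q. r * q mod 19) ` A = B"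
    using assms(3-5) card_image[OF inj] by (intro card_subset_eq) auto
  ultimately show ?thesis by (simp add: bij_betw_def)
qed

lemma QR19_mult_bij:
  assumes "r \<in> QR19" shows "bij_betw (\<lambda>q. r * q mod 19) QR19 QR19"
proof (rule mult_mod_19_bij)
  have "\<forall>r\<in>QR19. \<forall>q\<in>QR19. r * q mod 19 \<in> QR19" by simp
  then show "r * q mod 19 \<in> QR19" if "q \<in> QR19" for q using assms that by blast
qed (use assms in auto)

text \<open>The quadratic residues form a group, so multiplying the exponents by one of them only
  permutes the terms.\<close>

lemma gauss_period_power_QR:
  assumes "z ^ 19 = 1" "r \<in> QR19"
  shows "gauss_period (z ^ r) = gauss_period z"
proof -
  have "gauss_period (z ^ r) = (\<Sum>q\<in>QR19. z ^ (r * q mod 19))"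
    unfolding gauss_period_def power_mod_19[OF assms(1)] power_mult ..
  also have "\<dots> = gauss_period z"
    unfolding gauss_period_def by (rule sum.reindex_bij_betw[OF QR19_mult_bij[OF assms(2)]])
  finally show ?thesis .
qed

text \<open>Three cases for \<open>k\<close> modulo 19: zero gives nine ones, a residue permutes the
  terms, and a non-residue gives the complementary period, known from the vanishing of the sum of
  all powers.\<close>

lemma gauss_period_power:
  assumes "z ^ 19 = 1" "z \<noteq> 1"
  shows "gauss_period (z ^ k) \<in> {9, gauss_period z, - 1 - gauss_period z}"
proof -
  define r where "r = k mod 19"
  have zr: "z ^ k = z ^ r" by (simp add: r_def power_mod_19[OF assms(1)])
  consider "r = 0" | "r \<in> QR19" | "r \<in> {2, 3, 8, 10, 12, 13, 14, 15, 18}"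
  proof -
    have "r < 19" by (simp add: r_def)
    then have "r \<in> {0,1,2,3,4,5,6,7,8,9,10,11,12,13,14,15,16,17,18}"
      unfolding insert_iff empty_iff by presburger
    then show ?thesis using that by auto
  qed
  then show ?thesis
  proof cases
    case 1 then show ?thesis by (simp add: zr gauss_period_expand)
  next
    case 2 then show ?thesis by (simp only: zr gauss_period_power_QR[OF assms(1)]) simp
  next
    case 3
    let ?N = "{2, 3, 8, 10, 12, 13, 14, 15, 18} :: nat set"
    have "\<forall>r\<in>?N. \<forall>q\<in>QR19. r * q mod 19 \<in> ?N" by simp
    then have "r * q mod 19 \<in> ?N" if "q \<in> QR19" for q using 3 that by blast
    then have "bij_betw (\<lambda>q. r * q mod 19) QR19 ?N"
      by (rule mult_mod_19_bij[rotated 2]) (use 3 in auto)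
    then have "(\<Sum>q\<in>QR19. z ^ (r * q mod 19)) = (\<Sum>q\<in>?N. z ^ q)"
      by (rule sum.reindex_bij_betw)
    then have "gauss_period (z ^ r) = (\<Sum>q\<in>?N. z ^ q)"
      by (simp only: gauss_period_def power_mod_19[OF assms(1)] power_mult)
    also have "\<dots> = - 1 - gauss_period z"
      using cyclotomic_19[OF assms] by (simp add: gauss_period_expand) algebra
    finally show ?thesis by (simp add: zr)
  qed
qed

section \<open>The root of unity \<open>xi\<close> and the sign of its Gauss sum\<close>

lemma xi_power: "xi ^ k = exp (\<i> * of_real (2 * pi * real k / 19))"
  by (simp add: xi_def exp_of_nat_mult[symmetric] mult_ac)

lemma xi_power_eq_1_iff: "xi ^ k = 1 \<longleftrightarrow> 19 dvd k"
proof
  assume "xi ^ k = 1"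
  then obtain n :: int where "2 * pi * real k / 19 = of_int (2 * n) * pi"
    by (auto simp: xi_power exp_eq_1)
  then have "real_of_int (int k) = real_of_int (19 * n)" by (simp add: field_simps)
  then have "int k = 19 * n" by (simp only: of_int_eq_iff)
  then show "19 dvd k" by presburger
next
  assume "19 dvd k"
  then obtain m where k: "k = 19 * m" ..
  have "2 * pi * real k / 19 = of_int (2 * int m) * pi" by (simp add: k)
  then show "xi ^ k = 1" unfolding xi_power exp_eq_1 by (auto intro: exI[of _ "int m"])
qed

lemma xi_root: "xi ^ 19 = 1" and xi_neq_1: "xi \<noteq> 1"
  using xi_power_eq_1_iff[of 19] xi_power_eq_1_iff[of 1] by auto

lemma xi_power_inj:
  assumes "xi ^ a = xi ^ b" "a < 19" "b < 19" shows "a = b"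
  using assms
proof (induction a b rule: linorder_wlog)
  case (le a b)
  have "xi \<noteq> 0" using xi_root by auto
  moreover have "xi ^ b = xi ^ a * xi ^ (b - a)" using le(1) by (simp flip: power_add)
  ultimately have "xi ^ (b - a) = 1" using le(2) by auto
  then have "19 dvd b - a" by (simp only: xi_power_eq_1_iff)
  then show ?case using le by (auto dest: dvd_imp_le)
qed metis

lemma cnj_xi: "cnj xi = xi ^ 18"
proof -
  have "xi * cnj xi = 1" by (simp add: complex_norm_square[symmetric] xi_def)
  moreover have "xi * xi ^ 18 = 1" using xi_root by (simp flip: power_Suc)
  ultimately show ?thesis by (metis mult_cancel_left mult_zero_left zero_neq_one)
qed

text \<open>The two square roots of a residue are opposite, so exactly one of them lies in 1..9.
  This turns the sum defining \<open>nu\<close> into a Gauss period.\<close>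

lemma squares_mod_19: "bij_betw (\<lambda>j. j\<^sup>2 mod 19) {1..9} QR19"
proof -
  have "{1..9} = {1, 2, 3, 4, 5, 6, 7, 8, 9 :: nat}" by auto
  then show ?thesis by (simp add: bij_betw_def inj_on_def insert_commute)
qed

lemma nu_eq_gauss_period: "nu = gauss_period xi"
proof -
  have "nu = (\<Sum>j=1..9. xi ^ (j\<^sup>2 mod 19))" by (simp only: nu_def power_mod_19[OF xi_root])
  then show ?thesis
    unfolding gauss_period_def using sum.reindex_bij_betw[OF squares_mod_19, of "\<lambda>q. xi ^ q"] by simp
qed

lemma nu_squared: "nu\<^sup>2 = - nu - 5"
  unfolding nu_eq_gauss_period by (rule gauss_period_quadratic[OF xi_root xi_neq_1])

text \<open>
  The sign of the Gauss sum: each of the three negative terms of the imaginary part is dominated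
  by a positive one.
\<close>

lemma Im_nu_pos: "Im nu > 0"
proof -
  define s where "s k = sin (2 * pi * real k / 19)" for k
  have Im_xi: "Im (xi ^ k) = s k" for k by (simp add: xi_power s_def Im_exp)
  \<comment> \<open>The exponents 11, 16, 17 reflect to 8, 3, 2 and supply the three negative
    terms.\<close>
  have refl: "s (19 - k) = - s k" if "k \<le> 19" for k
  proof -
    have "2 * pi * real (19 - k) / 19 = 2 * pi - 2 * pi * real k / 19"
      using that by (simp add: of_nat_diff field_simps)
    then show ?thesis unfolding s_def by (metis sin_2pi_minus)
  qed
  have pos: "s k > 0" if "0 < k" "k \<le> 9" for k
    unfolding s_def using that by (intro sin_gt_zero) (auto simp: field_simps)
  have mono: "s j < s k" if "j < k" "k \<le> 4" for j k
    unfolding s_def using that pi_gt_zero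
    by (intro sin_monotone_2pi) (auto simp: field_simps intro: order_trans[of _ 0])
  \<comment> \<open>Arguments x beyond a quarter turn are replaced by pi - x, which lies where sine
    is increasing.\<close>
  have "s 8 < s 7"
  proof -
    have "s 8 = sin (pi - 2 * pi * 8 / 19)" "s 7 = sin (pi - 2 * pi * 7 / 19)" by (simp_all only: s_def sin_pi_minus of_nat_numeral)
    moreover have "sin (pi - 2 * pi * 8 / 19) < sin (pi - 2 * pi * 7 / 19)"
      using pi_gt_zero by (intro sin_monotone_2pi) (auto simp: field_simps)
    ultimately show ?thesis by simp
  qed
  moreover have "s 2 < s 4" "s 3 < s 4" using mono by simp_all
  moreover have "s 2 < s 5"
  proof -
    have "s 5 = sin (pi - 2 * pi * 5 / 19)" by (simp only: s_def sin_pi_minus of_nat_numeral)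
    moreover have "s 2 < sin (pi - 2 * pi * 5 / 19)"
      unfolding s_def using pi_gt_zero by (intro sin_monotone_2pi) (auto simp: field_simps)
    ultimately show ?thesis by simp
  qed
  moreover have "Im nu = s 1 + s 4 + s 5 + s 6 + s 7 + s 9 - s 8 - s 3 - s 2"
    using refl[of 8] refl[of 3] refl[of 2] Im_xi[of 1] Im_xi
    by (simp add: nu_eq_gauss_period gauss_period_expand)
  moreover have "s 1 > 0" "s 6 > 0" "s 9 > 0" using pos by simp_all
  ultimately show ?thesis by linarith
qed

text \<open>The quadratic equation determines 1 + 2\<nu> up to sign; positivity of
  \<open>Im nu\<close> selects the sign.\<close>

lemma nu_value: "nu = (- 1 + \<i> * of_real (sqrt 19)) / 2"
proof -
  have "(1 + 2 * nu)\<^sup>2 = (\<i> * of_real (sqrt 19))\<^sup>2"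
  proof -
    have "(1 + 2 * nu)\<^sup>2 = - 19" using nu_squared by algebra
    moreover have "(of_real (sqrt 19))\<^sup>2 = (19 :: complex)" by (simp flip: of_real_power)
    ultimately show ?thesis by (simp add: power_mult_distrib)
  qed
  then have "1 + 2 * nu = \<i> * of_real (sqrt 19) \<or> 1 + 2 * nu = - (\<i> * of_real (sqrt 19))"
    by (simp only: power2_eq_iff)
  moreover have "1 + 2 * nu \<noteq> - (\<i> * of_real (sqrt 19))"
  proof
    assume "1 + 2 * nu = - (\<i> * of_real (sqrt 19))"
    then have "Im (1 + 2 * nu) = Im (- (\<i> * of_real (sqrt 19)))" by simp
    moreover have "sqrt 19 > 0" by simp
    ultimately show False using Im_nu_pos by simp
  qed
  ultimately have "1 + 2 * nu = \<i> * of_real (sqrt 19)" by blast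
  then show ?thesis by (simp add: field_simps)
qed

section \<open>The embedded ring of integers\<close>

lemma int_adjoin_nu: "int_adjoin nu = {of_int a + of_int b * nu | a b :: int. True}"
proof (intro equalityI subsetI)
  fix x assume "x \<in> int_adjoin nu"
  then obtain p :: "int poly" where "x = poly (map_poly of_int p) nu" by (auto simp: int_adjoin_def)
  moreover have "\<exists>a b :: int. poly (map_poly of_int p) nu = of_int a + of_int b * nu"
  proof (induction p)
    case 0
    show ?case by (intro exI[of _ 0]) simp
  next
    case (pCons c p)
    then obtain a b :: int where "poly (map_poly of_int p) nu = of_int a + of_int b * nu" by blast
    then have "poly (map_poly of_int (pCons c p)) nu = of_int c + nu * (of_int a + of_int b * nu)"
      by (simp add: map_poly_pCons)
    \<comment> \<open>Horner step: substituting -\<nu> - 5 for the square of \<nu> stays in the span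
      of 1 and \<nu>.\<close>
    also have "\<dots> = of_int (c - 5 * b) + of_int (a - b) * nu"
      using nu_squared unfolding of_int_diff of_int_mult of_int_numeral by algebra
    finally show ?case by blast
  qed
  ultimately show "x \<in> {of_int a + of_int b * nu | a b :: int. True}" by blast
next
  fix x assume "x \<in> {of_int a + of_int b * nu | a b :: int. True}"
  then obtain a b :: int where "x = of_int a + of_int b * nu" by blast
  then have "x = poly (map_poly of_int [:a, b:]) nu" by (simp add: map_poly_pCons)
  then show "x \<in> int_adjoin nu" unfolding int_adjoin_def by blast
qed

lemma cnj_nu: "cnj nu = - 1 - nu"
  by (simp add: nu_value field_simps)

lemma int_adjoin_nu_of_int [intro]: "of_int n \<in> int_adjoin nu"
  unfolding int_adjoin_nu by (intro CollectI exI[of _ n] exI[of _ 0]) simp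

lemma int_adjoin_nu_add [intro]:
  assumes "x \<in> int_adjoin nu" "y \<in> int_adjoin nu" shows "x + y \<in> int_adjoin nu"
proof -
  from assms obtain a b c d :: int where "x = of_int a + of_int b * nu" "y = of_int c + of_int d * nu"
    unfolding int_adjoin_nu by blast
  then have "x + y = of_int (a + c) + of_int (b + d) * nu" by (simp add: algebra_simps)
  then show ?thesis unfolding int_adjoin_nu by blast
qed

lemma int_adjoin_nu_mult [intro]:
  assumes "x \<in> int_adjoin nu" "y \<in> int_adjoin nu" shows "x * y \<in> int_adjoin nu"
proof -
  from assms obtain a b c d :: int where "x = of_int a + of_int b * nu" "y = of_int c + of_int d * nu"
    unfolding int_adjoin_nu by blast
  then have "x * y = of_int (a * c - 5 * b * d) + of_int (a * d + b * c - b * d) * nu"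
    unfolding of_int_diff of_int_add of_int_mult of_int_numeral using nu_squared by algebra
  then show ?thesis unfolding int_adjoin_nu by blast
qed

lemma int_adjoin_nu_basic [simp, intro]:
  "0 \<in> int_adjoin nu" "1 \<in> int_adjoin nu" "numeral n \<in> int_adjoin nu" "nu \<in> int_adjoin nu"
  using int_adjoin_nu_of_int[of 0] int_adjoin_nu_of_int[of 1] int_adjoin_nu_of_int[of "numeral n"]
  by (simp_all, unfold int_adjoin_nu, intro CollectI exI[of _ 0] exI[of _ 1], simp)

lemma int_adjoin_nu_uminus [intro]: "x \<in> int_adjoin nu \<Longrightarrow> - x \<in> int_adjoin nu"
  using int_adjoin_nu_mult[OF int_adjoin_nu_of_int[of "- 1"], of x] by simp

lemma int_adjoin_nu_diff [intro]:
  "x \<in> int_adjoin nu \<Longrightarrow> y \<in> int_adjoin nu \<Longrightarrow> x - y \<in> int_adjoin nu"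
  using int_adjoin_nu_add[OF _ int_adjoin_nu_uminus] by force

section \<open>Coordinates of \<open>V\<close> and the tuple of conjugates of
  \<open>xi\<close>\<close>

lemma bij_of_nat_9: "bij_betw (of_nat :: nat \<Rightarrow> 9) {m..<m+9} UNIV"
proof -
  have inj: "inj_on (of_nat :: nat \<Rightarrow> 9) {m..<m+9}"
  proof (rule inj_onI)
    fix a b assume ab: "a \<in> {m..<m+9}" "b \<in> {m..<m+9}" "(of_nat a :: 9) = of_nat b"
    then have "[a = b] (mod CHAR(9))" by (simp only: of_nat_eq_iff_cong_CHAR)
    then have "[a - m = b - m] (mod 9)"
      using ab(1,2) cong_add_rcancel_nat[of "a - m" m "b - m" 9] by simp
    then have "a - m = b - m" using ab(1,2) by (auto intro: cong_less_modulus_unique_nat)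
    then show "a = b" using ab(1,2) unfolding atLeastLessThan_iff by linarith
  qed
  moreover have "of_nat ` {m..<m+9} = (UNIV :: 9 set)"
    by (rule card_subset_eq) (simp_all add: card_image[OF inj])
  ultimately show ?thesis by (simp add: bij_betw_def)
qed

lemma bij_of_nat_1_9: "bij_betw (of_nat :: nat \<Rightarrow> 9) {1..9} UNIV"
  using bij_of_nat_9[of 1] by (simp add: atLeastLessThanSuc_atLeastAtMost[symmetric] numeral_eq_Suc)

lemma sum_index_9: "(\<Sum>i\<in>(UNIV :: 9 set). f i) = (\<Sum>j=1..9. f (of_nat j))"
  by (rule sum.reindex_bij_betw[OF bij_of_nat_1_9, symmetric])

lemma index_9_cases:
  obtains j where "j \<in> {1..9}" "i = (of_nat j :: 9)"
  using bij_of_nat_1_9 unfolding bij_betw_def by blast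

text \<open>Multiplication on \<open>V\<close> is coordinatewise, which makes \<open>V\<close> the
  algebra of nine copies of \<complex>. Its unit 1 is the vector e_1 + ... + e_9, and
  \<open>zeta\<close> is the image of \<xi> under nine embeddings.\<close>

definition zeta :: V where
  "zeta = (\<chi> i. xi ^ (inv_into {1..9} of_nat i)\<^sup>2)"

lemma zeta_nth: "j \<in> {1..9} \<Longrightarrow> zeta $ of_nat j = xi ^ j\<^sup>2"
  using bij_of_nat_1_9 by (simp add: zeta_def bij_betw_def inv_into_f_f)

lemma zeta_exponent: "bij_betw (\<lambda>i. (inv_into {1..9} of_nat i)\<^sup>2 mod 19) (UNIV :: 9 set) QR19"
  using bij_betw_trans[OF bij_betw_inv_into[OF bij_of_nat_1_9] squares_mod_19] by (simp add: o_def)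

lemma zeta_nth': "zeta $ i = xi ^ ((inv_into {1..9} of_nat i)\<^sup>2 mod 19)"
  by (simp add: zeta_def power_mod_19[OF xi_root])

lemma sum_zeta: "(\<Sum>i\<in>UNIV. f (zeta $ i)) = (\<Sum>q\<in>QR19. f (xi ^ q))"
  unfolding zeta_nth' by (rule sum.reindex_bij_betw[OF zeta_exponent])

lemma zeta_cases: obtains q where "q \<in> QR19" "zeta $ i = xi ^ q"
  using zeta_nth' bij_betw_apply[OF zeta_exponent] by blast

lemma zeta_root: "(zeta $ i) ^ 19 = 1"
proof -
  obtain q where q: "zeta $ i = xi ^ q" by (rule zeta_cases)
  have "(zeta $ i) ^ 19 = (xi ^ 19) ^ q" unfolding q by (metis power_mult mult.commute)
  then show ?thesis by (simp add: xi_root)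
qed

lemma zeta_neq: "zeta $ i \<noteq> 1" "zeta $ i \<noteq> 0"
proof -
  obtain q where q: "q \<in> QR19" "zeta $ i = xi ^ q" by (rule zeta_cases)
  then show "zeta $ i \<noteq> 1" by (auto simp: xi_power_eq_1_iff)
  show "zeta $ i \<noteq> 0" using zeta_root[of i] by auto
qed

text \<open>This is the simplicity of the spectrum of \<open>tau_map\<close>; it also allows an
  index to be identified by its root of unity.\<close>

lemma zeta_inj: "zeta $ i = zeta $ k \<longleftrightarrow> i = k"
  unfolding zeta_nth' using xi_power_inj zeta_exponent
  by (metis (no_types, lifting) UNIV_I bij_betw_def inj_onD mod_less_divisor zero_less_numeral)

text \<open>The nine embeddings agree on the quadratic subfield. Hence scaling by \<open>nu\<close>
  is the same as multiplying by an element of the embedded ring, the sum of the powers of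
  \<open>zeta\<close> over \<open>QR19\<close>.\<close>

lemma gauss_period_zeta: "gauss_period (zeta $ i) = nu"
  by (rule zeta_cases[of i]) (simp only: gauss_period_power_QR[OF xi_root] nu_eq_gauss_period)

lemma cnj_zeta: "cnj (zeta $ i) = (zeta $ i) ^ 18"
  by (rule zeta_cases[of i]) (simp add: cnj_xi flip: power_mult, simp add: mult.commute)

lemma one_minus_zeta_neq: "1 - zeta $ i \<noteq> 0"
  using zeta_neq[of i] by simp

section \<open>The copy of \<int>[\<xi>] inside \<open>V\<close>\<close>

lemma vec_power_nth: "(x ^ n) $ i = (x $ i) ^ n" for x :: "'a::semiring_1 ^ 'n"
  by (induction n) simp_all

text \<open>The image of \<int>[\<xi>], generated additively by the powers of \<open>zeta\<close>.
  Closure under differences alone already yields zero, negatives and sums, and leaves only two cases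
  in each induction.\<close>

inductive_set cyc :: "V set" where
  pow: "zeta ^ k \<in> cyc"
| diff: "x \<in> cyc \<Longrightarrow> y \<in> cyc \<Longrightarrow> x - y \<in> cyc"

lemma cyc_zero: "0 \<in> cyc"
  using cyc.diff[OF cyc.pow[of 0] cyc.pow[of 0]] by simp

lemma cyc_uminus: "x \<in> cyc \<Longrightarrow> - x \<in> cyc"
  using cyc.diff[OF cyc_zero] by force

lemma cyc_add: "x \<in> cyc \<Longrightarrow> y \<in> cyc \<Longrightarrow> x + y \<in> cyc"
  using cyc.diff[OF _ cyc_uminus] by force

lemma cyc_sum: "(\<And>k. k \<in> I \<Longrightarrow> f k \<in> cyc) \<Longrightarrow> sum f I \<in> cyc"
  by (induction I rule: infinite_finite_induct) (auto intro: cyc_zero cyc_add)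

lemma cyc_mult:
  assumes "x \<in> cyc" "y \<in> cyc" shows "x * y \<in> cyc"
  using assms(1)
proof induction
  case (pow k)
  show ?case using assms(2)
  proof induction
    case (pow l) then show ?case using cyc.pow[of "k + l"] by (simp add: power_add)
  next
    case (diff u v) then show ?case using cyc.diff by (simp add: ring_distribs)
  qed
next
  case (diff u v) then show ?case using cyc.diff by (simp add: ring_distribs)
qed

lemma cyc_basic: "1 \<in> cyc" "zeta \<in> cyc"
  using cyc.pow[of 0] cyc.pow[of 1] by simp_all

lemma cyc_of_nat: "of_nat n \<in> cyc"
  by (induction n) (auto intro: cyc_zero cyc_add cyc_basic)

lemma cyc_numeral: "numeral n \<in> cyc"
  using cyc_of_nat[of "numeral n"] by simp

lemma cyc_power: "x \<in> cyc \<Longrightarrow> x ^ n \<in> cyc"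
  by (induction n) (auto intro: cyc_mult cyc_basic)

lemma cyc_of_int_scale: "x \<in> cyc \<Longrightarrow> of_int n *s x \<in> cyc"
proof -
  assume x: "x \<in> cyc"
  have n: "of_nat m *s x \<in> cyc" for m
    by (induction m) (auto simp: vector_sadd_rdistrib intro: cyc_zero cyc_add x)
  show ?thesis
    by (cases n rule: int_cases2) (use n cyc_uminus[OF n] in \<open>auto simp: vector_smult_lneg\<close>)
qed

lemma cyc_nu_scale: "x \<in> cyc \<Longrightarrow> nu *s x \<in> cyc"
proof -
  assume x: "x \<in> cyc"
  have "(\<Sum>q\<in>QR19. zeta ^ q) $ i = nu" for i
    using gauss_period_zeta[of i] by (simp only: gauss_period_def sum_component vec_power_nth)
  then have "nu *s x = (\<Sum>q\<in>QR19. zeta ^ q) * x"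
    by (simp only: vec_eq_iff vector_smult_component vector_mult_component) simp
  moreover have "(\<Sum>q\<in>QR19. zeta ^ q) \<in> cyc" by (rule cyc_sum) (rule cyc.pow)
  ultimately show ?thesis using cyc_mult[OF _ x] by simp
qed

lemma cyc_scale:
  assumes "r \<in> int_adjoin nu" "x \<in> cyc" shows "r *s x \<in> cyc"
proof -
  obtain a b :: int where "r = of_int a + of_int b * nu" using assms(1) unfolding int_adjoin_nu by blast
  then have "r *s x = of_int a *s x + of_int b *s (nu *s x)" by (simp add: vec_eq_iff algebra_simps)
  then show ?thesis using assms(2) by (simp only: cyc_add cyc_of_int_scale cyc_nu_scale)
qed

lemma cyc_cnj: "x \<in> cyc \<Longrightarrow> (\<chi> i. cnj (x $ i)) \<in> cyc"
proof (induction rule: cyc.induct)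
  case (pow k)
  have "(\<chi> i. cnj ((zeta ^ k) $ i)) = zeta ^ (18 * k)"
    by (simp add: vec_eq_iff vec_power_nth cnj_zeta power_mult)
  then show ?case using cyc.pow by simp
next
  case (diff x y)
  have "(\<chi> i. cnj ((x - y) $ i)) = (\<chi> i. cnj (x $ i)) - (\<chi> i. cnj (y $ i))" by (simp add: vec_eq_iff)
  then show ?case using diff cyc.diff by simp
qed

text \<open>Modulo the prime 1 - \<xi> every power of \<xi> is 1, so every residue class contains an
  integer.\<close>

lemma cyc_mod_one_minus_zeta:
  assumes "x \<in> cyc"
  shows "\<exists>n :: int. \<exists>y\<in>cyc. x = of_int n *s 1 + (1 - zeta) * y"
  using assms
proof induction
  case (pow k)
  show ?case
  proof (induction k)
    case 0
    show ?case by (intro exI[of _ 1] bexI[of _ 0]) (auto intro: cyc_zero)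
  next
    case (Suc k)
    then obtain n y where y: "y \<in> cyc" "zeta ^ k = of_int n *s 1 + (1 - zeta) * y" by blast
    have "zeta ^ Suc k = of_int n *s 1 + (1 - zeta) * (y - zeta ^ k)"
      using y(2) by (simp add: algebra_simps)
    then show ?case using y(1) cyc.diff cyc.pow by blast
  qed
next
  case (diff u v)
  then obtain n m x y where "u = of_int n *s 1 + (1 - zeta) * x" "v = of_int m *s 1 + (1 - zeta) * y"
    and "x \<in> cyc" "y \<in> cyc" by blast
  moreover from this have "u - v = of_int (n - m) *s 1 + (1 - zeta) * (x - y)"
    by (simp add: vec_eq_iff algebra_simps)
  ultimately show ?case using cyc.diff by blast
qed

text \<open>Summing the coordinates is taking the relative trace of \<open>\<int>[\<xi>]\<close> over \<open>\<int>[\<nu>]\<close>.\<close>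

lemma trace_zeta_power: "(\<Sum>i\<in>UNIV. (zeta $ i) ^ k) \<in> {9, nu, - 1 - nu}"
proof -
  have "(\<Sum>i\<in>UNIV. (zeta $ i) ^ k) = gauss_period (xi ^ k)"
    unfolding sum_zeta[of "\<lambda>z. z ^ k"] gauss_period_def power_mult[symmetric]
    by (simp only: mult.commute)
  then show ?thesis using gauss_period_power[OF xi_root xi_neq_1] by (simp add: nu_eq_gauss_period)
qed

text \<open>All three possible traces of a power of \<xi> are congruent to 9 modulo \<surd>-19, so
  the traces of consecutive powers differ by a multiple of \<surd>-19.\<close>

lemma trace_one_minus_zeta:
  assumes "x \<in> cyc"
  shows "\<exists>r\<in>int_adjoin nu. (\<Sum>i\<in>UNIV. (1 - zeta $ i) * x $ i) = (1 + 2 * nu) * r"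
  using assms
proof induction
  case (pow k)
  define t where "t k = (\<Sum>i\<in>UNIV. (zeta $ i) ^ k)" for k
  have "\<exists>r\<in>int_adjoin nu. t k = 9 + (1 + 2 * nu) * r" for k
  proof -
    have "nu = 9 + (1 + 2 * nu) * (1 + nu)" "- 1 - nu = 9 + (1 + 2 * nu) * nu"
      using nu_squared by algebra+
    moreover have "(9 :: complex) = 9 + (1 + 2 * nu) * 0" by simp
    moreover have "0 \<in> int_adjoin nu" "nu \<in> int_adjoin nu" "1 + nu \<in> int_adjoin nu" by auto
    moreover have "t k = 9 \<or> t k = nu \<or> t k = - 1 - nu"
      using trace_zeta_power[of k] by (simp add: t_def)
    ultimately show ?thesis by metis
  qed
  then obtain r r' where "r \<in> int_adjoin nu" "t k = 9 + (1 + 2 * nu) * r"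
    and "r' \<in> int_adjoin nu" "t (Suc k) = 9 + (1 + 2 * nu) * r'" by metis
  then have "r - r' \<in> int_adjoin nu" "t k - t (Suc k) = (1 + 2 * nu) * (r - r')"
    by (auto simp: right_diff_distrib)
  moreover have "(\<Sum>i\<in>UNIV. (1 - zeta $ i) * (zeta ^ k) $ i) = t k - t (Suc k)"
    by (simp add: t_def vec_power_nth sum_subtractf ring_distribs)
  ultimately show ?case by metis
next
  case (diff x y)
  then obtain r s where "r \<in> int_adjoin nu" "s \<in> int_adjoin nu"
    "(\<Sum>i\<in>UNIV. (1 - zeta $ i) * x $ i) = (1 + 2 * nu) * r"
    "(\<Sum>i\<in>UNIV. (1 - zeta $ i) * y $ i) = (1 + 2 * nu) * s" by blast
  then show ?case
    by (intro bexI[of _ "r - s"]) (auto simp: right_diff_distrib sum_subtractf)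
qed

section \<open>The lattice and its basis\<close>

abbreviation sqrt_m19 :: complex where "sqrt_m19 \<equiv> 1 + 2 * nu"

lemma sqrt_m19_squared: "sqrt_m19\<^sup>2 = - 19"
  using nu_squared by algebra

lemma sqrt_m19_neq_0: "sqrt_m19 \<noteq> 0"
  using sqrt_m19_squared by auto

lemma cnj_sqrt_m19: "cnj sqrt_m19 = - sqrt_m19"
  by (simp add: cnj_nu)

lemma sum_ebasis: "(\<Sum>j=1..9. coord j u *s ebasis j) = u"
proof -
  have "(\<Sum>j=1..9. coord j u *s ebasis j) = (\<Sum>i\<in>UNIV. u $ i *s axis i 1)"
    unfolding sum_index_9[of "\<lambda>i. u $ i *s axis i 1"] by (simp add: coord_def ebasis_def)
  also have "\<dots> = u" by (rule basis_expansion)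
  finally show ?thesis .
qed

lemma tau_map_eq: "tau_map u = zeta * u"
proof -
  have "tau_map u = (\<Sum>j=1..9. coord j (zeta * u) *s ebasis j)"
    unfolding tau_map_def by (rule sum.cong) (simp_all add: coord_def zeta_nth mult.commute)
  then show ?thesis by (simp only: sum_ebasis)
qed

lemma vvec_eq: "vvec k = zeta ^ k"
proof -
  have "(\<Sum>j=1..9. ebasis j) = 1" using sum_ebasis[of 1] by (simp add: coord_def)
  moreover have "(tau_map ^^ k) 1 = zeta ^ k" by (induction k) (simp_all add: tau_map_eq)
  ultimately show ?thesis by (simp add: vvec_def)
qed

definition lat_gen :: V where
  "lat_gen = (\<chi> i. (1 - zeta $ i) ^ 5 / sqrt_m19)"

text \<open>The coefficients 1, -5, 10, -10, 5, -1 are those of (1 - z)^5.\<close>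

lemma wvec_eq: "wvec k = lat_gen * zeta ^ k"
proof -
  have id: "p - 5*(p*z) + 10*(p*z^2) - 10*(p*z^3) + 5*(p*z^4) - p*z^5 = (1 - z)^5 * p"
    for p z :: complex by algebra
  have "wvec k $ i = (lat_gen * zeta ^ k) $ i" for i
  proof -
    define p z where "p = (zeta $ i) ^ k" and "z = zeta $ i"
    have "wvec k $ i = 1 / sqrt_m19 * (p - 5*(p*z) + 10*(p*z^2) - 10*(p*z^3) + 5*(p*z^4) - p*z^5)"
      by (simp only: wvec_def vvec_eq vector_smult_component vector_minus_component
          vector_add_component vector_mult_component vec_power_nth power_add power_one_right p_def z_def)
    then show ?thesis unfolding id by (simp add: lat_gen_def vec_power_nth p_def z_def)
  qed
  then show ?thesis by (simp add: vec_eq_iff)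
qed

text \<open>The two mutually inverse units relating \<open>\<surd>-19\<close> and \<open>(1 - \<xi>)\<^sup>9\<close>.\<close>

definition ram_unit :: V where
  "ram_unit = nu *s zeta + (-2-4*nu) *s zeta^2 + (5+9*nu) *s zeta^3 + (-7-13*nu) *s zeta^4
     + (6+13*nu) *s zeta^5 + (-4-9*nu) *s zeta^6 + (2+4*nu) *s zeta^7 + (-1-nu) *s zeta^8"

definition ram_unit_inv :: V where
  "ram_unit_inv = 3219 + 6538*zeta + 9596*zeta^2 + 12058*zeta^3 + 13653*zeta^4 + 14205*zeta^5
     + 13653*zeta^6 + 12058*zeta^7 + 9596*zeta^8 + 6538*zeta^9 + 3219*zeta^10 - 2772*zeta^12
     - 4801*zeta^13 - 5872*zeta^14 - 5872*zeta^15 - 4801*zeta^16 - 2772*zeta^17"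

lemma ram_unit_nth: "(1 - zeta $ i) ^ 9 = sqrt_m19 * ram_unit $ i"
  using ramification[OF zeta_root zeta_neq(1) gauss_period_zeta[symmetric], of i]
  by (simp only: ram_unit_def vector_add_component vector_smult_component vec_power_nth)

lemma ram_unit_inv_nth: "sqrt_m19 = (1 - zeta $ i) ^ 9 * ram_unit_inv $ i"
  using ramification_inverse[OF zeta_root zeta_neq(1) gauss_period_zeta[symmetric], of i]
  by (simp add: ram_unit_inv_def vec_power_nth)

lemma ram_unit_ram_unit_inv: "ram_unit $ i * ram_unit_inv $ i = 1"
proof -
  have "sqrt_m19 * (ram_unit $ i * ram_unit_inv $ i) = sqrt_m19"
    by (simp only: mult.assoc[symmetric] ram_unit_nth[symmetric] ram_unit_inv_nth[symmetric])
  then show ?thesis using sqrt_m19_neq_0 by (metis mult_cancel_left1)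
qed

lemma ram_unit_cyc: "ram_unit \<in> cyc"
proof -
  have "nu \<in> int_adjoin nu" "-2-4*nu \<in> int_adjoin nu" "5+9*nu \<in> int_adjoin nu"
    "-7-13*nu \<in> int_adjoin nu" "6+13*nu \<in> int_adjoin nu" "-4-9*nu \<in> int_adjoin nu"
    "2+4*nu \<in> int_adjoin nu" "-1-nu \<in> int_adjoin nu"
    by (intro int_adjoin_nu_add int_adjoin_nu_mult int_adjoin_nu_diff int_adjoin_nu_uminus int_adjoin_nu_basic)+
  then show ?thesis unfolding ram_unit_def by (intro cyc_add cyc_scale cyc_power cyc_basic)
qed

lemma ram_unit_inv_cyc: "ram_unit_inv \<in> cyc"
  unfolding ram_unit_inv_def by (intro cyc_add cyc.diff cyc_mult cyc_numeral cyc_power cyc_basic)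

definition lat :: "V set" where
  "lat = {lat_gen * x | x. x \<in> cyc}"

lemma lat_closed:
  "0 \<in> lat" "u \<in> lat \<Longrightarrow> v \<in> lat \<Longrightarrow> u + v \<in> lat" "u \<in> lat \<Longrightarrow> v \<in> lat \<Longrightarrow> u - v \<in> lat"
  "r \<in> int_adjoin nu \<Longrightarrow> u \<in> lat \<Longrightarrow> r *s u \<in> lat" "x \<in> cyc \<Longrightarrow> u \<in> lat \<Longrightarrow> x * u \<in> lat"
proof -
  have "0 = lat_gen * 0" by simp
  then show "0 \<in> lat" unfolding lat_def using cyc_zero by blast
  show "u + v \<in> lat" if "u \<in> lat" "v \<in> lat"
    using that unfolding lat_def by (auto simp flip: distrib_left intro: cyc_add)
  show "u - v \<in> lat" if "u \<in> lat" "v \<in> lat"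
    using that unfolding lat_def by (auto simp flip: right_diff_distrib intro: cyc.diff)
  show "r *s u \<in> lat" if r: "r \<in> int_adjoin nu" and u: "u \<in> lat"
  proof -
    obtain y where "y \<in> cyc" "u = lat_gen * y" using u by (auto simp: lat_def)
    moreover have "r *s (lat_gen * y) = lat_gen * (r *s y)" for y by (simp add: vec_eq_iff)
    ultimately show ?thesis unfolding lat_def using cyc_scale[OF r] by auto
  qed
  show "x * u \<in> lat" if x: "x \<in> cyc" and u: "u \<in> lat"
  proof -
    obtain y where y: "y \<in> cyc" "u = lat_gen * y" using u by (auto simp: lat_def)
    have "x * u = lat_gen * (x * y)" by (simp only: y(2) mult.left_commute)
    then show ?thesis unfolding lat_def using cyc_mult[OF x y(1)] by blast
  qed
qed

lemma lat_sum: "(\<And>k. k \<in> I \<Longrightarrow> f k \<in> lat) \<Longrightarrow> sum f I \<in> lat"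
  by (induction I rule: infinite_finite_induct) (auto intro: lat_closed)

lemma add_subgroup_lat: "add_subgroup lat"
  using lat_closed by (auto simp: add_subgroup_def)

text \<open>Up to a unit the generator is (1 - \<xi>)^-4, so its inverse lies in \<open>cyc\<close>
  and the lattice contains \<open>cyc\<close>.\<close>

lemma lat_gen_unit: "lat_gen * ((1 - zeta) ^ 4 * ram_unit_inv) = 1"
proof -
  have "(1 - z) ^ 5 / s * ((1 - z) ^ 4 * a) = ((1 - z) ^ 9 * a) / s" for z s a :: complex
    by (simp add: mult.assoc flip: power_add)
  then show ?thesis
    using sqrt_m19_neq_0 by (simp add: vec_eq_iff lat_gen_def vec_power_nth ram_unit_inv_nth[symmetric])
qed

lemma cyc_subset_lat: "x \<in> cyc \<Longrightarrow> x \<in> lat"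
proof -
  assume x: "x \<in> cyc"
  have "lat_gen * ((1 - zeta) ^ 4 * ram_unit_inv * x) = lat_gen * ((1 - zeta) ^ 4 * ram_unit_inv) * x"
    by (simp only: mult.assoc)
  then have "x = lat_gen * ((1 - zeta) ^ 4 * ram_unit_inv * x)" by (simp only: lat_gen_unit mult_1)
  moreover have "(1 - zeta) ^ 4 * ram_unit_inv * x \<in> cyc"
    by (intro cyc_mult cyc_power cyc.diff cyc_basic ram_unit_inv_cyc x)
  ultimately show ?thesis unfolding lat_def by blast
qed

lemma wvec_lat: "wvec k \<in> lat"
  unfolding wvec_eq lat_def using cyc.pow by blast

lemma vvec_lat: "vvec k \<in> lat"
  unfolding vvec_eq by (rule cyc_subset_lat) (rule cyc.pow)

section \<open>The \<int>[\<nu>]-basis of the lattice\<close>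

definition basis_map :: "V \<Rightarrow> V" where
  "basis_map z = (\<Sum>k=0..3. z $ of_nat k *s wvec k) + (\<Sum>k=4..8. z $ of_nat k *s vvec k)"

definition basis_span :: "V set" where
  "basis_span = {(\<Sum>k=0..3. a k *s wvec k) + (\<Sum>k=4..8. a k *s vvec k) | a.
     \<forall>k\<in>{0..8}. a k \<in> int_adjoin nu}"

lemma basis_spanI:
  assumes "\<And>k. k \<le> 8 \<Longrightarrow> a k \<in> int_adjoin nu"
  shows "(\<Sum>k=0..3. a k *s wvec k) + (\<Sum>k=4..8. a k *s vvec k) \<in> basis_span"
  using assms unfolding basis_span_def by auto

text \<open>This presents the span as the image of the lattice of the product of nine elliptic
  curves; once \<open>basis_map\<close> is known to be bijective, it gives the isomorphism of
  tori.\<close>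

lemma basis_span_eq_image: "basis_span = basis_map ` lattice_power (int_adjoin nu)"
proof (intro equalityI subsetI)
  fix x assume "x \<in> basis_span"
  then obtain a where x: "x = (\<Sum>k=0..3. a k *s wvec k) + (\<Sum>k=4..8. a k *s vvec k)"
    and a: "\<forall>k\<in>{0..8}. a k \<in> int_adjoin nu" unfolding basis_span_def by blast
  \<comment> \<open>The nine basis vectors are numbered from 0, whereas the coordinates of
    \<open>V\<close> are numbered from 1.\<close>
  have bij: "bij_betw (of_nat :: nat \<Rightarrow> 9) {0..8} UNIV"
    using bij_of_nat_9[of 0] by (simp add: atLeastLessThanSuc_atLeastAtMost[symmetric] numeral_eq_Suc)
  define z :: V where "z = (\<chi> i. a (inv_into {0..8} of_nat i))"
  have "z $ of_nat k = a k" if "k \<in> {0..8}" for k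
    using bij that by (simp only: z_def bij_betw_def inv_into_f_f vec_lambda_beta)
  then have "x = basis_map z" by (simp add: x basis_map_def)
  moreover have "z \<in> lattice_power (int_adjoin nu)"
    using a bij_betw_apply[OF bij_betw_inv_into[OF bij]] by (simp only: z_def lattice_power_def) simp
  ultimately show "x \<in> basis_map ` lattice_power (int_adjoin nu)" by blast
next
  fix x assume "x \<in> basis_map ` lattice_power (int_adjoin nu)"
  then obtain z where z: "z \<in> lattice_power (int_adjoin nu)" and x: "x = basis_map z" by blast
  show "x \<in> basis_span"
    unfolding basis_span_def x basis_map_def
    by (intro CollectI exI[of _ "\<lambda>k. z $ of_nat k"]) (use z in \<open>simp add: lattice_power_def\<close>)
qed

lemma basis_span_diff:
  assumes "x \<in> basis_span" "y \<in> basis_span" shows "x - y \<in> basis_span"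
proof -
  obtain a where x: "x = (\<Sum>k=0..3. a k *s wvec k) + (\<Sum>k=4..8. a k *s vvec k)"
    and a: "\<forall>k\<in>{0..8}. a k \<in> int_adjoin nu" using assms(1) unfolding basis_span_def by blast
  obtain b where y: "y = (\<Sum>k=0..3. b k *s wvec k) + (\<Sum>k=4..8. b k *s vvec k)"
    and b: "\<forall>k\<in>{0..8}. b k \<in> int_adjoin nu" using assms(2) unfolding basis_span_def by blast
  have "x - y = (\<Sum>k=0..3. (a k - b k) *s wvec k) + (\<Sum>k=4..8. (a k - b k) *s vvec k)"
    by (simp add: x y vector_sub_rdistrib sum_subtractf)
  also have "\<dots> \<in> basis_span" by (rule basis_spanI) (use a b in auto)
  finally show ?thesis .
qed

lemma basis_span_scale:
  assumes "r \<in> int_adjoin nu" "x \<in> basis_span" shows "r *s x \<in> basis_span"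
proof -
  obtain a where x: "x = (\<Sum>k=0..3. a k *s wvec k) + (\<Sum>k=4..8. a k *s vvec k)"
    and a: "\<forall>k\<in>{0..8}. a k \<in> int_adjoin nu" using assms(2) unfolding basis_span_def by blast
  have "r *s x = (\<Sum>k=0..3. (r * a k) *s wvec k) + (\<Sum>k=4..8. (r * a k) *s vvec k)"
    by (simp add: x vec.scale_right_distrib vec.scale_sum_right)
  also have "\<dots> \<in> basis_span" by (rule basis_spanI) (use a assms(1) in auto)
  finally show ?thesis .
qed

lemma basis_span_zero: "0 \<in> basis_span"
  unfolding basis_span_def by (intro CollectI exI[of _ "\<lambda>_. 0"]) simp

lemma basis_span_add: "x \<in> basis_span \<Longrightarrow> y \<in> basis_span \<Longrightarrow> x + y \<in> basis_span"
  using basis_span_diff[OF _ basis_span_diff[OF basis_span_zero]] by force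

lemma basis_span_sum: "(\<And>k. k \<in> I \<Longrightarrow> f k \<in> basis_span) \<Longrightarrow> sum f I \<in> basis_span"
  by (induction I rule: infinite_finite_induct) (auto intro: basis_span_zero basis_span_add)

lemma wvec_basis_span: "k \<le> 3 \<Longrightarrow> wvec k \<in> basis_span"
  unfolding basis_span_def
  by (intro CollectI exI[of _ "\<lambda>j. if j = k then 1 else 0"]) (simp add: if_distrib[of "\<lambda>c. c *s _"] cong: if_cong)

text \<open>The definition of \<open>wvec k\<close>, solved for \<open>vvec k\<close>, expresses it
  through \<open>wvec k\<close> and the next five vectors. Starting from the indices 4 to 8,
  downward recursion reaches 3, 2, 1 and 0.\<close>

lemma vvec_basis_span: assumes "k \<le> 8" shows "vvec k \<in> basis_span"
proof -
  have up: "vvec k \<in> basis_span" if "4 \<le> k" "k \<le> 8" for k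
    unfolding basis_span_def using that
    by (intro CollectI exI[of _ "\<lambda>j. if j = k then 1 else 0"]) (simp add: if_distrib[of "\<lambda>c. c *s _"] cong: if_cong)
  have rec: "vvec k = sqrt_m19 *s wvec k + 5 *s vvec (k + 1) - 10 *s vvec (k + 2)
      + 10 *s vvec (k + 3) - 5 *s vvec (k + 4) + vvec (k + 5)" for k
  proof -
    have "sqrt_m19 *s wvec k = vvec k - 5 *s vvec (k + 1) + 10 *s vvec (k + 2)
        - 10 *s vvec (k + 3) + 5 *s vvec (k + 4) - vvec (k + 5)"
      unfolding wvec_def vector_smult_assoc using sqrt_m19_neq_0 by simp
    then show ?thesis by (simp only:) simp
  qed
  have step: "vvec k \<in> basis_span"
    if "k \<le> 3" "vvec (k + 1) \<in> basis_span" "vvec (k + 2) \<in> basis_span" "vvec (k + 3) \<in> basis_span"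
      "vvec (k + 4) \<in> basis_span" "vvec (k + 5) \<in> basis_span" for k
    by (subst rec)
      (intro basis_span_add basis_span_diff basis_span_scale that wvec_basis_span
        int_adjoin_nu_add int_adjoin_nu_mult int_adjoin_nu_basic)
  have 3: "vvec 3 \<in> basis_span" by (rule step) (simp_all add: up)
  have 2: "vvec 2 \<in> basis_span" by (rule step) (simp_all add: up 3)
  have 1: "vvec 1 \<in> basis_span" by (rule step)
    (simp_all add: up 3 2 3[unfolded numeral_3_eq_3] 2[unfolded numeral_2_eq_2])
  have 0: "vvec 0 \<in> basis_span" by (rule step)
    (use 1 in \<open>simp_all add: up 3 2 3[unfolded numeral_3_eq_3] 2[unfolded numeral_2_eq_2]\<close>)
  consider "k = 0" | "k = 1" | "k = 2" | "k = 3" | "4 \<le> k" by linarith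
  then show ?thesis using 0 1 2 3 up[OF _ assms] by cases auto
qed

text \<open>Multiplication by \<open>zeta\<close> shifts all indices by one. Within the lists of
  generators only \<open>wvec 4\<close> and \<open>vvec 9\<close> are new, and each is shown to lie
  in the span.\<close>

lemma zeta_basis_span:
  assumes "x \<in> basis_span" shows "zeta * x \<in> basis_span"
proof -
  have R: "c \<in> int_adjoin nu"
    if "c \<in> {nu, 1+nu, -2, 1-nu, 3+nu, -2+nu, -2-nu, 2, -2-4*nu, 5+9*nu, -7-13*nu,
      6+13*nu, -4-9*nu, 2+4*nu, -1-nu, -1, 4, -6}" for c
    using that by (elim insertE emptyE) (simp only:, intro int_adjoin_nu_add int_adjoin_nu_mult
      int_adjoin_nu_diff int_adjoin_nu_uminus int_adjoin_nu_basic)+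
  have zk: "zeta ^ k \<in> basis_span" if "k \<le> 8" for k
    using vvec_basis_span[OF that] by (simp add: vvec_eq)
  have z0: "1 \<in> basis_span" and z1: "zeta \<in> basis_span" using zk[of 0] zk[of 1] by simp_all
  \<comment> \<open>This is \<open>vvec 9\<close>, rewritten by the equation of \<xi> over
    \<int>[\<nu>].\<close>
  have "zeta ^ 9 = 1 + (1+nu) *s zeta + (-2) *s zeta^2 + (1-nu) *s zeta^3 + (3+nu) *s zeta^4
      + (-2+nu) *s zeta^5 + (-2-nu) *s zeta^6 + 2 *s zeta^7 + nu *s zeta^8"
    using gauss_period_minpoly[OF zeta_root zeta_neq(1) gauss_period_zeta[symmetric]]
    by (simp only: vec_eq_iff vector_add_component vector_smult_component vec_power_nth one_index) simp
  also have "\<dots> \<in> basis_span"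
    by (intro basis_span_add basis_span_scale R zk z0 z1) simp_all
  finally have v: "vvec (Suc k) \<in> basis_span" if "k \<le> 8" for k
    using that zk[of "Suc k"] by (cases "k = 8") (simp_all add: vvec_eq eval_nat_numeral)
  have "ram_unit \<in> basis_span"
    unfolding ram_unit_def by (intro basis_span_add basis_span_scale R zk z1) simp_all
  \<comment> \<open>Multiplying the generator \<open>wvec 0\<close> by (1 - \<xi>)^4 gives (1 -
    \<xi>)^9 / \<surd>-19, which is \<open>ram_unit\<close>, a combination of vectors
    \<open>vvec k\<close>. Expanding the binomial and solving for the last term yields
    \<open>wvec 4\<close>.\<close>
  moreover have "wvec 4 = ram_unit + (-1) *s wvec 0 + 4 *s wvec 1 + (-6) *s wvec 2 + 4 *s wvec 3"
  proof -
    have "ram_unit $ i = (1 - zeta $ i) ^ 4 * lat_gen $ i" for i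
      using ram_unit_nth[of i] sqrt_m19_neq_0 by (simp add: lat_gen_def field_simps flip: power_add)
    moreover have "w * z^4 = (1 - z)^4 * w - w + 4 * (w * z) - 6 * (w * z^2) + 4 * (w * z^3)"
      for w z :: complex by algebra
    ultimately show ?thesis by (simp add: vec_eq_iff wvec_eq vec_power_nth)
  qed
  ultimately have w4: "wvec 4 \<in> basis_span"
    by (simp only:) (intro basis_span_add basis_span_scale R wvec_basis_span; simp)
  have w: "wvec (Suc k) \<in> basis_span" if "k \<le> 3" for k
    using that wvec_basis_span[of "Suc k"] w4 by (cases "k = 3") (simp_all add: eval_nat_numeral)
  obtain a where x: "x = (\<Sum>k=0..3. a k *s wvec k) + (\<Sum>k=4..8. a k *s vvec k)"
    and a: "\<forall>k\<in>{0..8}. a k \<in> int_adjoin nu" using assms unfolding basis_span_def by blast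
  have "zeta * (c *s y) = c *s (zeta * y)" for c y by (simp add: vec_eq_iff)
  then have "zeta * x = (\<Sum>k=0..3. a k *s wvec (Suc k)) + (\<Sum>k=4..8. a k *s vvec (Suc k))"
    by (simp add: x distrib_left sum_distrib_left vvec_eq wvec_eq mult.left_commute)
  also have "\<dots> \<in> basis_span"
    by (intro basis_span_add basis_span_sum basis_span_scale v w) (use a in auto)
  finally show ?thesis .
qed

text \<open>The span contains the generator \<open>wvec 0\<close> and is stable under
  \<open>zeta\<close>, hence contains the whole ideal.\<close>

lemma lat_eq_basis_span: "lat = basis_span"
proof (intro equalityI subsetI)
  fix x assume "x \<in> basis_span"
  then show "x \<in> lat"
    unfolding basis_span_def by (auto intro!: lat_closed lat_sum wvec_lat vvec_lat)
next
  fix u assume "u \<in> lat"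
  then obtain x where x: "x \<in> cyc" and u: "u = lat_gen * x" by (auto simp: lat_def)
  from x show "u \<in> basis_span" unfolding u
  proof induction
    case (pow k)
    show ?case
    proof (induction k)
      case 0 show ?case using wvec_basis_span[of 0] by (simp add: wvec_eq)
    next
      case (Suc k) then show ?case
        using zeta_basis_span by (simp add: mult.left_commute[of lat_gen zeta])
    qed
  next
    case (diff x y) then show ?case using basis_span_diff by (simp add: right_diff_distrib)
  qed
qed

section \<open>Self-duality\<close>

definition herm :: "V \<Rightarrow> V \<Rightarrow> complex" where
  "herm u v = (\<Sum>i\<in>UNIV. u $ i * cnj (v $ i))"

lemma herm_add_left: "herm (u + v) w = herm u w + herm v w"
  and herm_diff_left: "herm (u - v) w = herm u w - herm v w"
  by (simp_all add: herm_def distrib_right left_diff_distrib sum.distrib sum_subtractf)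

lemma herm_scale_left: "herm (c *s u) w = c * herm u w"
  and herm_scale_right: "herm u (c *s w) = cnj c * herm u w"
  and herm_mult_left: "herm (x * u) w = herm u ((\<chi> i. cnj (x $ i)) * w)"
  by (simp_all add: herm_def sum_distrib_left mult_ac)

lemma herm_commute: "herm v u = cnj (herm u v)"
  by (simp add: herm_def mult.commute)

text \<open>The conjugate of 1 - z is -z^18 (1 - z), whose fifth power is -z^14 (1 - z)^5; its sign
  cancels that of the conjugate of \<surd>-19. Of the tenth power of 1 - z, nine factors absorb one
  \<surd>-19, leaving the single factor that the trace estimate needs.\<close>

lemma lat_gen_norm: "lat_gen $ i * cnj (lat_gen $ i) = (1 - zeta $ i) * (zeta ^ 14 * ram_unit) $ i / sqrt_m19"
proof -
  define z where "z = zeta $ i"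
  have z: "z ^ 19 = 1" by (simp add: z_def zeta_root)
  have eq: "(1 - z ^ 18) ^ 5 = - (z ^ 14 * (1 - z) ^ 5)" using z by algebra
  have "cnj (lat_gen $ i) = (1 - z ^ 18) ^ 5 / cnj sqrt_m19"
    by (simp add: lat_gen_def cnj_zeta z_def)
  then have "cnj (lat_gen $ i) = (z ^ 14 * (1 - z) ^ 5) / sqrt_m19"
    by (simp only: eq cnj_sqrt_m19 minus_divide_divide minus_minus minus_divide_left[symmetric] minus_divide_right[symmetric])
  then have "lat_gen $ i * cnj (lat_gen $ i) = (1 - z) ^ 10 * z ^ 14 / sqrt_m19\<^sup>2"
    by (simp add: lat_gen_def z_def power2_eq_square flip: power_add)
  also have "(1 - z) ^ 10 = (1 - z) * (sqrt_m19 * ram_unit $ i)"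
    using power_Suc[of "1 - z" 9] ram_unit_nth[of i] by (simp add: z_def)
  finally show ?thesis
    using sqrt_m19_neq_0 by (simp add: z_def vec_power_nth power2_eq_square)
qed

text \<open>By \<open>lat_gen_norm\<close> the pairing is the trace of a multiple of 1 - \<xi>,
  divided by \<surd>-19; \<open>trace_one_minus_zeta\<close> cancels the denominator.\<close>

lemma herm_lat:
  assumes "u \<in> lat" "v \<in> lat" shows "herm u v \<in> int_adjoin nu"
proof -
  obtain x y where x: "x \<in> cyc" "u = lat_gen * x" and y: "y \<in> cyc" "v = lat_gen * y"
    using assms by (auto simp: lat_def)
  define t where "t = zeta ^ 14 * ram_unit * x * (\<chi> i. cnj (y $ i))"
  have "t \<in> cyc" unfolding t_def by (intro cyc_mult cyc.pow ram_unit_cyc x cyc_cnj y)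
  have "herm u v = (\<Sum>i\<in>UNIV. (lat_gen $ i * cnj (lat_gen $ i)) * (x $ i * cnj (y $ i)))"
    by (simp add: herm_def x y mult_ac)
  also have "\<dots> = (\<Sum>i\<in>UNIV. (1 - zeta $ i) * t $ i) / sqrt_m19"
    unfolding lat_gen_norm sum_divide_distrib by (intro sum.cong) (simp_all add: t_def mult_ac)
  finally show ?thesis
    using trace_one_minus_zeta[OF \<open>t \<in> cyc\<close>] sqrt_m19_neq_0 by auto
qed

definition dual_lat :: "V set" where
  "dual_lat = {u. \<forall>l\<in>lat. herm u l \<in> int_adjoin nu}"

lemma dual_lat_mult: "x \<in> cyc \<Longrightarrow> u \<in> dual_lat \<Longrightarrow> x * u \<in> dual_lat"
  unfolding dual_lat_def using lat_closed(5)[OF cyc_cnj] by (auto simp: herm_mult_left)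

text \<open>Orthogonality of characters of the group of order 19: for distinct coordinates the sum
  over \<open>k\<close> is a full geometric sum of a nontrivial root of unity. It serves to bound
  the dual lattice and to show that the powers of \<open>zeta\<close> span \<open>V\<close>.\<close>

lemma tight_frame: "19 *s u = (\<Sum>k<19. herm u (zeta ^ k) *s zeta ^ k)"
proof -
  have "(\<Sum>k<19. herm u (zeta ^ k) *s zeta ^ k) $ m = 19 * u $ m" for m
  proof -
    define c where "c i = cnj (zeta $ i) * zeta $ m" for i
    have geom: "(\<Sum>k<19. (c i) ^ k) = (if i = m then 19 else 0)" for i
    proof (cases "i = m")
      case True
      then have "c i = 1" using zeta_root[of m] by (simp add: c_def cnj_zeta flip: power_Suc2)
      then show ?thesis using True by simp
    next
      case False
      have "zeta $ i * c i = (zeta $ i) ^ 19 * zeta $ m" by (simp add: c_def cnj_zeta flip: power_Suc)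
      then have "c i \<noteq> 1" using False zeta_root[of i] zeta_inj[of i m] by auto
      moreover have "(c i) ^ 19 = cnj ((zeta $ i) ^ 19) * (zeta $ m) ^ 19"
        by (simp add: c_def power_mult_distrib)
      then have "(c i) ^ 19 = 1" by (simp add: zeta_root del: complex_cnj_power)
      ultimately show ?thesis using False geometric_sum[of "c i" 19] by simp
    qed
    have "(\<Sum>k<19. herm u (zeta ^ k) *s zeta ^ k) $ m = (\<Sum>k<19. \<Sum>i\<in>UNIV. u $ i * (c i) ^ k)"
      by (simp add: herm_def vec_power_nth sum_distrib_left sum_distrib_right c_def
          power_mult_distrib mult_ac)
    also have "\<dots> = (\<Sum>i\<in>UNIV. \<Sum>k<19. u $ i * (c i) ^ k)" by (rule sum.swap)
    also have "\<dots> = (\<Sum>i\<in>UNIV. u $ i * (if i = m then 19 else 0))"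
      by (simp only: sum_distrib_left[symmetric] geom)
    also have "\<dots> = 19 * u $ m" by (simp add: if_distrib cong: if_cong)
    finally show ?thesis .
  qed
  then show ?thesis by (simp add: vec_eq_iff)
qed

text \<open>Total ramification of 19, obtained by squaring the relation between \<surd>-19 and (1 -
  \<xi>)^9.\<close>

lemma nineteen_eq: "19 *s x = - ((1 - zeta) ^ 18 * ram_unit_inv ^ 2 * x)"
proof -
  have eq: "19 = - ((1 - zeta $ i) ^ 18 * ram_unit_inv $ i ^ 2)" for i
  proof -
    have "sqrt_m19\<^sup>2 = ((1 - zeta $ i) ^ 9 * ram_unit_inv $ i)\<^sup>2" by (simp flip: ram_unit_inv_nth)
    then show ?thesis unfolding sqrt_m19_squared by (simp add: power_mult_distrib flip: power_mult)
  qed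
  have "19 * x $ i = - ((1 - zeta $ i) ^ 18 * ram_unit_inv $ i ^ 2) * x $ i" for i
    by (simp only: eq[of i, symmetric])
  then show ?thesis by (simp add: vec_eq_iff vec_power_nth)
qed

text \<open>
  An element of the dual annihilated modulo \<open>lat\<close> by the prime \<open>1 - \<xi>\<close> is, modulo \<open>lat\<close>, an
  integer multiple \<open>n / (1 - \<xi>)\<close> of the generator; a suitable pairing yields \<open>9 n / \<surd>-19\<close>, whose
  integrality forces \<open>19\<close> to divide \<open>n\<close>.
\<close>

lemma dual_lat_descend:
  assumes u: "u \<in> dual_lat" and m: "(1 - zeta) * u \<in> lat"
  shows "u \<in> lat"
proof -
  obtain x where x: "x \<in> cyc" "(1 - zeta) * u = lat_gen * x" using m by (auto simp: lat_def)
  obtain n y where y: "y \<in> cyc" "x = of_int n *s 1 + (1 - zeta) * y"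
    using cyc_mod_one_minus_zeta[OF x(1)] by blast
  define u' where "u' = u - lat_gen * y"
  have ly: "lat_gen * y \<in> lat" using y(1) by (auto simp: lat_def)
  have u': "u' \<in> dual_lat"
    using u herm_lat[OF ly] by (auto simp: u'_def dual_lat_def herm_diff_left)
  have u'_nth: "u' $ i = of_int n * lat_gen $ i / (1 - zeta $ i)" for i
  proof -
    have "(1 - zeta $ i) * u $ i = lat_gen $ i * (of_int n + (1 - zeta $ i) * y $ i)"
      using x(2) unfolding y(2) vec_eq_iff by (auto dest: spec[of _ i])
    then have "(1 - zeta $ i) * u' $ i = of_int n * lat_gen $ i"
      by (simp add: u'_def algebra_simps)
    then show ?thesis using one_minus_zeta_neq[of i] by (simp add: field_simps)
  qed
  \<comment> \<open>The pairing undoes the conjugation. The factor \<open>zeta ^ 5\<close> completes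
    the \<open>zeta ^ 14\<close> of \<open>lat_gen_norm\<close> to 1 and \<open>ram_unit_inv\<close>
    cancels \<open>ram_unit\<close>, so all nine coordinates contribute equally.\<close>
  define w where "w = lat_gen * (\<chi> i. cnj ((zeta ^ 5 * ram_unit_inv) $ i))"
  have "w \<in> lat"
    unfolding lat_def w_def using cyc_cnj[OF cyc_mult[OF cyc.pow ram_unit_inv_cyc]] by blast
  have "u' $ i * cnj (w $ i) = of_int n / sqrt_m19" for i
  proof -
    have "u' $ i * cnj (w $ i)
        = of_int n * (lat_gen $ i * cnj (lat_gen $ i)) * (zeta $ i ^ 5 * ram_unit_inv $ i) / (1 - zeta $ i)"
      by (simp add: u'_nth w_def vec_power_nth mult_ac)
    also have "\<dots> = of_int n * (zeta $ i ^ 14 * zeta $ i ^ 5) * (ram_unit $ i * ram_unit_inv $ i) / sqrt_m19"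
      unfolding lat_gen_norm using one_minus_zeta_neq[of i] by (simp add: vec_power_nth mult_ac)
    also have "zeta $ i ^ 14 * zeta $ i ^ 5 = 1" using zeta_root[of i] by (simp flip: power_add)
    finally show ?thesis by (simp add: ram_unit_ram_unit_inv)
  qed
  then have "herm u' w = 9 * (of_int n / sqrt_m19)" by (simp only: herm_def sum_constant) simp
  moreover have "herm u' w \<in> int_adjoin nu" using u' \<open>w \<in> lat\<close> by (auto simp: dual_lat_def)
  ultimately obtain a b :: int where "9 * (of_int n / sqrt_m19) = of_int a + of_int b * nu"
    unfolding int_adjoin_nu by auto
  then have "9 * of_int n = sqrt_m19 * (of_int a + of_int b * nu)"
    using sqrt_m19_neq_0 by (simp add: field_simps)
  then have eq: "of_int (9 * n - (a - 10 * b)) = of_int (2 * a - b) * nu"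
    using nu_squared unfolding of_int_diff of_int_mult of_int_numeral by algebra
  then have "Im (of_int (9 * n - (a - 10 * b))) = Im (of_int (2 * a - b) * nu)" by (rule arg_cong)
  then have "2 * a - b = 0" using Im_nu_pos by simp
  with eq have "complex_of_int (9 * n - (a - 10 * b)) = 0" by simp
  then have "9 * n - (a - 10 * b) = 0" by (simp only: of_int_eq_0_iff)
  \<comment> \<open>From b = 2a follows 9n = -19a; the multipliers come from 17 * 9 - 8 * 19 =
    1.\<close>
  with \<open>2 * a - b = 0\<close> have "n = 19 * (- 17 * a - 8 * n)" by algebra
  then obtain k where k: "n = 19 * k" ..
  have "u' = lat_gen * (of_int k *s (- ((1 - zeta) ^ 17 * ram_unit_inv ^ 2)))"
  proof -
    have "(19 *s (1::V)) $ i = - ((1 - zeta $ i) * ((1 - zeta $ i) ^ 17 * ram_unit_inv $ i ^ 2))" for i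
      unfolding nineteen_eq by (simp add: vec_power_nth flip: power_Suc mult.assoc)
    then have "19 / (1 - zeta $ i) = - ((1 - zeta $ i) ^ 17 * ram_unit_inv $ i ^ 2)" for i
      using one_minus_zeta_neq[of i] by (simp add: field_simps)
    then have "of_int k * lat_gen $ i * (19 / (1 - zeta $ i))
        = of_int k * lat_gen $ i * (- ((1 - zeta $ i) ^ 17 * ram_unit_inv $ i ^ 2))" for i by simp
    then show ?thesis by (simp add: vec_eq_iff u'_nth k vec_power_nth mult_ac)
  qed
  moreover have "of_int k *s (- ((1 - zeta) ^ 17 * ram_unit_inv ^ 2)) \<in> cyc"
    by (intro cyc_of_int_scale cyc_uminus cyc_mult cyc_power cyc.diff cyc_basic ram_unit_inv_cyc)
  ultimately have "u' \<in> lat" unfolding lat_def by blast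
  then have "u' + lat_gen * y \<in> lat" using ly by (rule lat_closed)
  then show ?thesis by (simp add: u'_def)
qed

text \<open>Pairing a dual vector with the powers of \<open>zeta\<close> shows, by
  \<open>tight_frame\<close>, that 19 times it lies in \<open>cyc\<close>. Hence (1 - \<xi>)^18
  carries it into the lattice, and \<open>dual_lat_descend\<close> strips off these factors one by
  one.\<close>

lemma dual_lat_eq: "dual_lat = lat"
proof (intro equalityI subsetI)
  fix u assume u: "u \<in> dual_lat"
  have "19 *s u \<in> cyc"
    unfolding tight_frame
    by (intro cyc_sum cyc_scale cyc.pow) (use u in \<open>auto simp: dual_lat_def cyc_subset_lat cyc.pow\<close>)
  moreover have "(1 - zeta) ^ 18 * u = - (ram_unit ^ 2 * (19 *s u))"
    unfolding nineteen_eq using ram_unit_ram_unit_inv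
    by (simp add: vec_eq_iff vec_power_nth mult_ac flip: power_mult_distrib)
  ultimately have "(1 - zeta) ^ 18 * u \<in> lat"
    by (simp only:) (intro cyc_subset_lat cyc_uminus cyc_mult cyc_power ram_unit_cyc)
  moreover have "u \<in> lat" if "(1 - zeta) ^ n * u \<in> lat" for n
    using that
  proof (induction n)
    case (Suc n)
    have "(1 - zeta) ^ n * u \<in> dual_lat"
      by (intro dual_lat_mult cyc_power cyc.diff cyc_basic u)
    then show ?case using Suc dual_lat_descend by (simp add: mult.assoc)
  qed simp
  ultimately show "u \<in> lat" by blast
qed (auto simp: dual_lat_def herm_lat)

section \<open>The linear isomorphism given by the basis\<close>

lemma complex_linear_basis_map: "Vector_Spaces.linear (*s) (*s) basis_map"
  by unfold_locales
    (simp_all add: basis_map_def vec.scale_right_distrib vec.scale_left_distrib sum.distrib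
      vec.scale_sum_right)

text \<open>The range contains the lattice, hence all powers of \<open>zeta\<close>, which span
  \<open>V\<close>; equality of dimensions then gives injectivity.\<close>

lemma bij_basis_map: "bij basis_map"
proof -
  interpret L: Vector_Spaces.linear "(*s)" "(*s)" basis_map by (rule complex_linear_basis_map)
  have "u \<in> range basis_map" for u
  proof -
    have "zeta ^ k \<in> range basis_map" for k
      using cyc_subset_lat[OF cyc.pow[of k]] unfolding lat_eq_basis_span basis_span_eq_image by blast
    then have "\<forall>k. \<exists>z. zeta ^ k = basis_map z" by blast
    then obtain z where z: "\<And>k. zeta ^ k = basis_map (z k)" by (auto dest: choice)
    have "u = (1 / 19) *s (19 *s u)" by (simp add: vec_eq_iff)
    also have "\<dots> = basis_map ((1 / 19) *s (\<Sum>k<19. herm u (zeta ^ k) *s z k))"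
      unfolding tight_frame by (simp add: L.scale L.sum z)
    finally show ?thesis by blast
  qed
  then have surj: "surj basis_map" by blast
  moreover have "linear basis_map"
    using complex_linear_bounded_linear[OF complex_linear_basis_map] by (rule bounded_linear.linear)
  ultimately show ?thesis using linear_surjective_imp_injective by (auto simp: bij_def)
qed

text \<open>The factor 2/\<surd>19 is the reciprocal of \<open>Im nu\<close>. With it, pairing y = a
  + b \<nu> for real a, b against the basis 1, \<nu> returns b and -a, so integrality of both values
  means that y lies in \<int>[\<nu>].\<close>

lemma int_adjoin_nu_imag_iff:
  fixes y :: complex
  shows "y \<in> int_adjoin nu \<longleftrightarrow> Im (2 / sqrt 19 * y) \<in> \<int> \<and> Im (2 / sqrt 19 * (cnj nu * y)) \<in> \<int>"
proof -
  define b where "b = Im y * 2 / sqrt 19"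
  define a where "a = Re y + b / 2"
  have s: "sqrt 19 > 0" "sqrt 19 * sqrt 19 = 19" by simp_all
  have nu: "Re nu = - 1 / 2" "Im nu = sqrt 19 / 2" by (simp_all add: nu_value)
  have y: "y = of_real a + of_real b * nu"
    using s(1) by (simp add: complex_eq_iff nu a_def b_def)
  have 1: "Im (2 / sqrt 19 * y) = b" using s(1) by (simp add: b_def)
  have "cnj nu * y = of_real (5 * b - a) - of_real a * nu"
    using nu_squared unfolding y cnj_nu of_real_diff of_real_mult of_real_numeral by algebra
  then have 2: "Im (2 / sqrt 19 * (cnj nu * y)) = - a" using s(1) by (simp add: nu)
  have "y \<in> int_adjoin nu \<longleftrightarrow> a \<in> \<int> \<and> b \<in> \<int>"
  proof
    assume "y \<in> int_adjoin nu"
    then obtain c d :: int where cd: "y = of_int c + of_int d * nu" unfolding int_adjoin_nu by blast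
    then have "b = d" using y s(1) by (simp add: complex_eq_iff nu)
    moreover have "a = c" using cd y \<open>b = d\<close> by (simp add: complex_eq_iff nu)
    ultimately show "a \<in> \<int> \<and> b \<in> \<int>" by simp
  next
    assume "a \<in> \<int> \<and> b \<in> \<int>"
    then obtain c d :: int where "a = of_int c" "b = of_int d" by (auto elim!: Ints_cases)
    then have "y = of_int c + of_int d * nu" by (simp add: y)
    then show "y \<in> int_adjoin nu" unfolding int_adjoin_nu by blast
  qed
  then show ?thesis unfolding 1 2 by auto
qed

section \<open>The principal polarization\<close>

definition theta :: "V \<Rightarrow> V \<Rightarrow> complex" where
  "theta u v = 2 / sqrt 19 * herm u v"

text \<open>The lattice is stable under \<nu>, so the imaginary part may be tested on both l and
  \<nu> l. This turns the integral dual into the \<int>[\<nu>]-valued dual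
  \<open>dual_lat\<close>.\<close>

lemma theta_dual: "{u. \<forall>l\<in>lat. Im (theta u l) \<in> \<int>} = lat"
proof -
  have "(\<forall>l\<in>lat. Im (theta u l) \<in> \<int>) \<longleftrightarrow> (\<forall>l\<in>lat. herm u l \<in> int_adjoin nu)" for u
  proof (intro iffI ballI)
    fix l assume "\<forall>l\<in>lat. Im (theta u l) \<in> \<int>" and l: "l \<in> lat"
    moreover from l have "nu *s l \<in> lat" by (intro lat_closed) auto
    ultimately have "Im (theta u l) \<in> \<int>" "Im (theta u (nu *s l)) \<in> \<int>" by blast+
    then show "herm u l \<in> int_adjoin nu"
      using int_adjoin_nu_imag_iff[of "herm u l"] unfolding theta_def herm_scale_right by simp
  next
    fix l assume "\<forall>l\<in>lat. herm u l \<in> int_adjoin nu" "l \<in> lat"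
    then show "Im (theta u l) \<in> \<int>" using int_adjoin_nu_imag_iff[of "herm u l"] by (simp add: theta_def)
  qed
  then show ?thesis using dual_lat_eq unfolding dual_lat_def by simp
qed

lemma herm_pos: "u \<noteq> 0 \<Longrightarrow> Re (herm u u) > 0"
proof -
  assume "u \<noteq> 0"
  then obtain i where i: "u $ i \<noteq> 0" by (auto simp: vec_eq_iff)
  have "Re (herm u u) = (\<Sum>i\<in>UNIV. (cmod (u $ i))\<^sup>2)"
    by (simp only: herm_def Re_sum complex_norm_square[symmetric] Re_complex_of_real)
  also have "\<dots> > 0" by (rule sum_pos2[of _ i]) (use i in auto)
  finally show ?thesis .
qed

lemma theta_principal: "principal_polarization lat theta"
proof -
  have "hermitian_form theta"
    unfolding hermitian_form_def
  proof (intro conjI allI)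
    show "Vector_Spaces.linear (*s) (*) (\<lambda>u. theta u v)" for v
      by unfold_locales (simp_all add: theta_def herm_add_left herm_scale_left algebra_simps add_divide_distrib)
    show "theta v u = cnj (theta u v)" for u v
      by (simp add: theta_def herm_commute[of v u])
  qed
  then show ?thesis
    using theta_dual herm_pos unfolding principal_polarization_def polarization_def
    by (auto simp: theta_def)
qed

section \<open>Automorphisms and uniqueness\<close>

lemma res19_eqI:
  assumes "u \<le> 9" "t mod 19 = int u \<or> t mod 19 = (- int u) mod 19"
  shows "res19 t = u"
  unfolding res19_def
proof (rule the_equality)
  have m: "int v mod 19 = int v" "(- int v) mod 19 = (if v = 0 then 0 else 19 - int v)"
    if "v \<le> 9" for v using that by (simp_all add: zmod_zminus1_eq_if)
  show "u \<le> 9 \<and> (t mod 19 = int u mod 19 \<or> t mod 19 = (- int u) mod 19)"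
    using assms by simp
  fix v assume "v \<le> 9 \<and> (t mod 19 = int v mod 19 \<or> t mod 19 = (- int v) mod 19)"
  then show "v = u" using assms m[of u] m[of v] by (auto split: if_splits)
qed

lemma range_1_9: "{1..9} = {1, 2, 3, 4, 5, 6, 7, 8, 9 :: nat}"
  by auto

lemma res19_3: "res19 3 = 3" "res19 6 = 6" "res19 9 = 9" "res19 12 = 7" "res19 15 = 4"
  "res19 18 = 1" "res19 21 = 2" "res19 24 = 5" "res19 27 = 8"
  by (rule res19_eqI; simp)+

lemma res19_6: "res19 30 = 8" "res19 36 = 2" "res19 42 = 4" "res19 48 = 9" "res19 54 = 3"
  by (rule res19_eqI; simp)+

lemma res19_props:
  "j \<in> {1..9} \<Longrightarrow> res19 (3 * int j) \<in> {1..9}"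
  "j \<in> {1..9} \<Longrightarrow> (res19 (3 * int j))\<^sup>2 mod 19 = 9 * j\<^sup>2 mod 19"
  "j \<in> {1..9} \<Longrightarrow> res19 (6 * int j) \<in> {1..9}"
  "j \<in> {1..9} \<Longrightarrow> m \<in> {1..9} \<Longrightarrow> res19 (6 * int j) = m \<longleftrightarrow> j = res19 (3 * int m)"
proof -
  have "\<forall>j\<in>{1..9}. res19 (3 * int j) \<in> {1..9} \<and> (res19 (3 * int j))\<^sup>2 mod 19 = 9 * j\<^sup>2 mod 19
      \<and> res19 (6 * int j) \<in> {1..9}"
    unfolding range_1_9 by (simp add: res19_3 res19_6)
  moreover have "\<forall>j\<in>{1..9}. \<forall>m\<in>{1..9}. res19 (6 * int j) = m \<longleftrightarrow> j = res19 (3 * int m)"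
    unfolding range_1_9 by (simp add: res19_3 res19_6)
  ultimately show "j \<in> {1..9} \<Longrightarrow> res19 (3 * int j) \<in> {1..9}"
    "j \<in> {1..9} \<Longrightarrow> (res19 (3 * int j))\<^sup>2 mod 19 = 9 * j\<^sup>2 mod 19"
    "j \<in> {1..9} \<Longrightarrow> res19 (6 * int j) \<in> {1..9}"
    "j \<in> {1..9} \<Longrightarrow> m \<in> {1..9} \<Longrightarrow> res19 (6 * int j) = m \<longleftrightarrow> j = res19 (3 * int m)"
    by blast+
qed

text \<open>The multiplier \<open>3\<close> appears because it is, up to sign, the inverse of \<open>6\<close> modulo \<open>19\<close>.\<close>

definition sigma_perm :: "9 \<Rightarrow> 9" where
  "sigma_perm i = of_nat (res19 (3 * int (inv_into {1..9} of_nat i)))"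

lemma sigma_perm_of_nat: "j \<in> {1..9} \<Longrightarrow> sigma_perm (of_nat j) = of_nat (res19 (3 * int j))"
  using bij_of_nat_1_9 by (simp add: sigma_perm_def bij_betw_def inv_into_f_f)

text \<open>Moving basis vectors by a permutation of the indices pulls coordinates back along the
  inverse permutation.\<close>

lemma sigma_map_nth: "sigma_map u $ i = u $ sigma_perm i"
proof (rule index_9_cases[of i])
  fix m assume m: "m \<in> {1..9}" "i = of_nat m"
  have "(ebasis (res19 (6 * int j)) :: V) $ i = (if j = res19 (3 * int m) then 1 else 0)"
    if j: "j \<in> {1..9}" for j
  proof -
    have "(of_nat (res19 (6 * int j)) :: 9) = of_nat m \<longleftrightarrow> res19 (6 * int j) = m"
      using bij_of_nat_1_9 res19_props(3)[OF j] m(1) by (meson bij_betw_def inj_on_eq_iff)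
    then show ?thesis using res19_props(4)[OF j m(1)] by (simp add: ebasis_def axis_def m(2) eq_commute)
  qed
  then have "sigma_map u $ i = (\<Sum>j=1..9. coord j u * (if j = res19 (3 * int m) then 1 else 0))"
    by (simp add: sigma_map_def)
  also have "\<dots> = coord (res19 (3 * int m)) u"
    using res19_props(1)[OF m(1)] by (simp add: if_distrib cong: if_cong)
  finally show ?thesis by (simp only: coord_def sigma_perm_of_nat[OF m(1)] m(2))
qed

text \<open>Tripling an index multiplies its square by 9; this is why \<open>sigma_map\<close> acts
  as the Galois automorphism.\<close>

lemma zeta_sigma_perm: "zeta $ sigma_perm i = (zeta $ i) ^ 9"
proof (rule index_9_cases[of i])
  fix j assume j: "j \<in> {1..9}" "i = of_nat j"
  have "zeta $ sigma_perm i = xi ^ ((res19 (3 * int j))\<^sup>2 mod 19)"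
    using res19_props(1)[OF j(1)] by (simp only: j(2) sigma_perm_of_nat[OF j(1)] zeta_nth power_mod_19[OF xi_root])
  also have "\<dots> = xi ^ (9 * j\<^sup>2)" unfolding res19_props(2)[OF j(1)] power_mod_19[OF xi_root] ..
  finally show ?thesis
    by (simp only: j(2) zeta_nth[OF j(1)] power_mult[symmetric] mult.commute[of 9])
qed

lemma zeta_sigma_perm_funpow: "zeta $ (sigma_perm ^^ n) i = (zeta $ i) ^ (9 ^ n)"
  by (induction n) (simp_all add: zeta_sigma_perm mult.commute flip: power_mult)

text \<open>9^9 is 1 modulo 19, and an index is determined by its coordinate of
  \<open>zeta\<close>.\<close>

lemma sigma_perm_order: "(sigma_perm ^^ 9) i = i"
proof -
  have "zeta $ (sigma_perm ^^ 9) i = (zeta $ i) ^ (9 ^ 9 mod 19)"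
    by (simp only: zeta_sigma_perm_funpow power_mod_19[OF zeta_root])
  then show ?thesis by (simp add: zeta_inj)
qed

lemma bij_sigma_perm: "bij sigma_perm"
proof -
  have "inj sigma_perm"
  proof (rule injI)
    fix i j assume "sigma_perm i = sigma_perm j"
    then have "(sigma_perm ^^ 9) i = (sigma_perm ^^ 9) j" by (simp add: eval_nat_numeral)
    then show "i = j" by (simp only: sigma_perm_order)
  qed
  then show ?thesis by (simp add: bij_def finite_UNIV_inj_surj)
qed

section \<open>Stability of the lattice and of the form under both automorphisms\<close>

lemma cyc_sigma: "x \<in> cyc \<Longrightarrow> sigma_map x \<in> cyc"
proof (induction rule: cyc.induct)
  case (pow k)
  have "sigma_map (zeta ^ k) = zeta ^ (9 * k)"
    by (simp add: vec_eq_iff sigma_map_nth vec_power_nth zeta_sigma_perm flip: power_mult)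
  then show ?case using cyc.pow by simp
next
  case (diff x y)
  have "sigma_map (x - y) = sigma_map x - sigma_map y" by (simp add: vec_eq_iff sigma_map_nth)
  then show ?case using diff cyc.diff by simp
qed

text \<open>The quotient \<open>g\<close> of 1 - \<xi>^9 by 1 - \<xi> lies in the ring, so the
  Galois automorphism multiplies the generator by \<open>g ^ 5\<close>; the scalar \<surd>-19 is the
  same in all coordinates and is unaffected.\<close>

lemma lat_sigma: "sigma_map ` lat \<subseteq> lat"
proof
  fix v assume "v \<in> sigma_map ` lat"
  then obtain x where x: "x \<in> cyc" "v = sigma_map (lat_gen * x)" by (auto simp: lat_def)
  define g where "g = 1 + zeta + zeta^2 + zeta^3 + zeta^4 + zeta^5 + zeta^6 + zeta^7 + zeta^8"
  have "1 - zeta $ i ^ 9 = (1 - zeta $ i) * g $ i" for i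
    unfolding g_def vector_add_component vec_power_nth one_index by algebra
  then have "v = lat_gen * (g ^ 5 * sigma_map x)"
    by (simp add: x(2) vec_eq_iff sigma_map_nth lat_gen_def zeta_sigma_perm vec_power_nth power_mult_distrib)
  moreover have "g ^ 5 * sigma_map x \<in> cyc"
    unfolding g_def by (intro cyc_mult cyc_power cyc_add cyc_basic cyc_sigma x)
  ultimately show "v \<in> lat" unfolding lat_def by blast
qed

lemma lat_tau: "tau_map ` lat \<subseteq> lat"
  using lat_closed(5)[OF cyc_basic(2)] by (auto simp: tau_map_eq)

text \<open>The inverse of \<open>L\<close> is its n-th iterate, which also maps \<open>A\<close>
  into itself.\<close>

lemma finite_order_preserves:
  assumes "L ^^ Suc n = id" and sub: "L ` A \<subseteq> A"
  shows "bij L" "L ` A = A"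
proof -
  have 1: "L ((L ^^ n) x) = x" for x using assms(1) by (metis comp_apply funpow.simps(2) id_apply)
  have 2: "(L ^^ n) (L x) = x" for x using assms(1) by (metis comp_apply funpow_Suc_right id_apply)
  show "bij L" by (rule o_bij[of "L ^^ n"]) (auto simp: fun_eq_iff 1 2)
  have "(L ^^ m) x \<in> A" if "x \<in> A" for m x
    using that sub by (induction m) auto
  then have "A \<subseteq> L ` A" using 1 by (metis image_eqI subsetI)
  with sub show "L ` A = A" by blast
qed

lemma tau_map_order: "tau_map ^^ Suc 18 = id"
proof -
  have "(tau_map ^^ n) u = zeta ^ n * u" for n u
    by (induction n) (simp_all add: tau_map_eq mult.assoc)
  then have "(tau_map ^^ Suc 18) u = u" for u
    by (simp only: vec_eq_iff vector_mult_component vec_power_nth) (simp add: zeta_root del: power_Suc)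
  then show ?thesis by (intro ext) (simp only: id_apply)
qed

lemma sigma_map_order: "sigma_map ^^ Suc 8 = id"
proof -
  have "(sigma_map ^^ n) u $ i = u $ (sigma_perm ^^ n) i" for n u i
    by (induction n arbitrary: i) (simp_all add: sigma_map_nth funpow_swap1[of sigma_perm])
  then have "(sigma_map ^^ Suc 8) u = u" for u
    unfolding vec_eq_iff using sigma_perm_order by simp
  then show ?thesis by (intro ext) (simp only: id_apply)
qed

lemma complex_linear_tau: "Vector_Spaces.linear (*s) (*s) tau_map"
  by unfold_locales (simp_all add: tau_map_eq vec_eq_iff algebra_simps)

lemma complex_linear_sigma: "Vector_Spaces.linear (*s) (*s) sigma_map"
  by unfold_locales (simp_all add: sigma_map_nth vec_eq_iff)

text \<open>\<open>sigma_map\<close> permutes the coordinates and \<open>tau_map\<close> multiplies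
  each by a number of absolute value one.\<close>

lemma theta_invariant: "form_pullback sigma_map theta = theta" "form_pullback tau_map theta = theta"
proof -
  have "herm (sigma_map u) (sigma_map v) = herm u v" for u v
    unfolding herm_def sigma_map_nth
    by (rule sum.reindex_bij_betw[OF bij_sigma_perm, of "\<lambda>i. u $ i * cnj (v $ i)"])
  then show "form_pullback sigma_map theta = theta" by (simp add: form_pullback_def theta_def fun_eq_iff)
  have z: "zeta $ i * cnj (zeta $ i) = 1" for i
    using zeta_root[of i] by (simp add: cnj_zeta flip: power_Suc)
  have "(zeta $ i * a) * cnj (zeta $ i * b) = (zeta $ i * cnj (zeta $ i)) * (a * cnj b)" for i a b
    by simp
  then have "(zeta $ i * a) * cnj (zeta $ i * b) = a * cnj b" for i a b
    by (simp only: z mult_1)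
  then have "herm (tau_map u) (tau_map v) = herm u v" for u v
    by (simp only: herm_def tau_map_eq vector_mult_component)
  then show "form_pullback tau_map theta = theta" by (simp add: form_pullback_def theta_def fun_eq_iff)
qed

section \<open>Uniqueness of the invariant polarization\<close>

lemma hermitian_form_expand:
  assumes "hermitian_form H"
  shows "H u v = (\<Sum>i\<in>UNIV. \<Sum>k\<in>UNIV. u $ i * cnj (v $ k) * H (axis i 1) (axis k 1))"
proof -
  have lin: "Vector_Spaces.linear (*s) (*) (\<lambda>u. H u v)" and comm: "cnj (H v u) = H u v" for u v
    using assms unfolding hermitian_form_def by (blast, metis)
  have left: "H u w = (\<Sum>i\<in>UNIV. u $ i * H (axis i 1) w)" for u w
  proof -
    interpret Vector_Spaces.linear "(*s)" "(*)" "\<lambda>u. H u w" by (rule lin)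
    have "H (\<Sum>i\<in>UNIV. u $ i *s axis i 1) w = (\<Sum>i\<in>UNIV. u $ i * H (axis i 1) w)"
      by (simp add: sum scale)
    then show ?thesis by (simp only: basis_expansion)
  qed
  have right: "H w v = (\<Sum>k\<in>UNIV. cnj (v $ k) * H w (axis k 1))" for w
    using arg_cong[OF left[of v w], of cnj] by (simp add: comm)
  show ?thesis
    unfolding left[of u v] right[of "axis _ 1"] by (simp add: sum_distrib_left mult_ac)
qed

lemma invariant_form_scalar:
  assumes H: "hermitian_form H"
    and s: "form_pullback sigma_map H = H" and t: "form_pullback tau_map H = H"
  shows "H u v = H (axis 1 1) (axis 1 1) * herm u v"
proof -
  have lin: "Vector_Spaces.linear (*s) (*) (\<lambda>u. H u v)" and comm: "cnj (H v u) = H u v" for u v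
    using H unfolding hermitian_form_def by (blast, metis)
  have scale: "H (a *s x) y = a * H x y" for a x y
  proof -
    interpret Vector_Spaces.linear "(*s)" "(*)" "\<lambda>u. H u y" by (rule lin)
    show ?thesis by (rule scale)
  qed
  have scale': "H x (a *s y) = cnj a * H x y" for a x y
    using arg_cong[OF scale[of a y x], of cnj] by (simp add: comm)
  have off: "H (axis i 1) (axis k 1) = 0" if "i \<noteq> k" for i k
  proof -
    have tau_axis: "tau_map (axis i 1) = zeta $ i *s axis i 1" for i
      by (simp add: tau_map_eq vec_eq_iff axis_def)
    have "H (tau_map (axis i 1)) (tau_map (axis k 1)) = H (axis i 1) (axis k 1)"
      using fun_cong[OF fun_cong[OF t]] unfolding form_pullback_def .
    then have eq: "zeta $ i * (zeta $ k) ^ 18 * H (axis i 1) (axis k 1) = H (axis i 1) (axis k 1)"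
      by (simp only: tau_axis scale scale' cnj_zeta mult_ac)
    \<comment> \<open>The 18th power is the conjugate, so the product is the quotient of two
      distinct eigenvalues.\<close>
    have "zeta $ i * (zeta $ k) ^ 18 \<noteq> 1"
    proof
      assume "zeta $ i * (zeta $ k) ^ 18 = 1"
      then have "zeta $ i * (zeta $ k) ^ 19 = zeta $ k" by (simp add: eval_nat_numeral)
      then show False using that by (simp add: zeta_root zeta_inj)
    qed
    then show ?thesis using eq by simp
  qed
  define d where "d i = H (axis i 1) (axis i 1)" for i
  have step: "d i = d (sigma_perm i)" for i
  proof -
    have "sigma_map (axis (sigma_perm i) 1) = axis i 1"
      using bij_sigma_perm by (auto simp: vec_eq_iff sigma_map_nth axis_def bij_def inj_eq)
    then show ?thesis
      using fun_cong[OF fun_cong[OF s], of "axis (sigma_perm i) 1" "axis (sigma_perm i) 1"]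
      by (simp add: form_pullback_def d_def)
  qed
  have e: "d (of_nat j) = d (of_nat (res19 (3 * int j)))" if "j \<in> {1..9}" for j
    using step[of "of_nat j"] sigma_perm_of_nat[OF that] by simp
  \<comment> \<open>Tripling up to sign runs through 1, 3, 9, 8, 5, 4, 7, 2, 6, a single
    orbit.\<close>
  have d: "d i = d 1" for i
  proof (rule index_9_cases[of i])
    fix j assume "j \<in> {1..9}" "i = of_nat j"
    then show "d i = d 1"
      using e[of 1] e[of 3] e[of 9] e[of 8] e[of 5] e[of 4] e[of 7] e[of 2]
      unfolding range_1_9 by (auto simp: res19_3)
  qed
  have diag: "H (axis i 1) (axis i 1) = d 1" for i
    using d[of i] by (simp only: d_def)
  have "H u v = (\<Sum>i\<in>UNIV. \<Sum>k\<in>UNIV. if k = i then u $ i * cnj (v $ i) * d 1 else 0)"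
    unfolding hermitian_form_expand[OF H, of u v]
    by (intro sum.cong refl) (auto simp: off diag)
  also have "\<dots> = d 1 * herm u v" by (simp add: herm_def sum_distrib_left mult_ac)
  finally show ?thesis by (simp add: d_def)
qed

text \<open>\<open>wvec 0\<close> belongs to a \<int>[\<nu>]-basis of the lattice, so the factor
  lies in \<int>[\<nu>], whose real elements are the integers.\<close>

lemma real_multiple_wvec_lat:
  assumes "of_real r *s wvec 0 \<in> lat" shows "r \<in> \<int>"
proof -
  have "(of_nat k :: 9) = 0 \<longleftrightarrow> k = 0" if "k \<le> 8" for k
    using that by (auto simp: of_nat_eq_0_iff_char_dvd dest: dvd_imp_le)
  then have nth: "axis 0 c $ (of_nat k :: 9) = (if k = 0 then c else 0)" if "k \<le> 8" for k and c :: complex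
    using that by (simp add: axis_def)
  have "basis_map (axis 0 c) = (\<Sum>k=0..3. (if k = 0 then c else 0) *s wvec k)
      + (\<Sum>k=4..8. (if k = 0 then c else 0) *s vvec k)" for c
    unfolding basis_map_def by (intro arg_cong2[of _ _ _ _ "(+)"] sum.cong) (auto simp: nth)
  then have "basis_map (axis 0 c) = c *s wvec 0" for c
    by (simp add: if_distrib[of "\<lambda>c. c *s _"] cong: if_cong)
  then have "basis_map (axis 0 (of_real r)) \<in> basis_map ` lattice_power (int_adjoin nu)"
    using assms unfolding lat_eq_basis_span basis_span_eq_image by simp
  then have "axis 0 (of_real r) \<in> (lattice_power (int_adjoin nu) :: V set)"
    using bij_basis_map by (simp add: bij_def inj_image_mem_iff)
  then have "of_real r \<in> int_adjoin nu" by (auto simp: lattice_power_def axis_def split: if_splits)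
  then obtain a b :: int where "of_real r = of_int a + of_int b * nu" unfolding int_adjoin_nu by blast
  then have "r = a"
    using Im_nu_pos by (auto simp: complex_eq_iff)
  then show ?thesis by simp
qed

lemma invariant_principal_unique:
  assumes pp: "principal_polarization lat H"
    and inv: "form_pullback sigma_map H = H" "form_pullback tau_map H = H"
  shows "H = theta"
proof -
  have herm: "hermitian_form H" and pos: "\<And>u. u \<noteq> 0 \<Longrightarrow> Re (H u u) > 0"
    and int: "\<And>l m. l \<in> lat \<Longrightarrow> m \<in> lat \<Longrightarrow> Im (H l m) \<in> \<int>"
    and dual: "{u. \<forall>l\<in>lat. Im (H u l) \<in> \<int>} = lat"
    using pp by (auto simp: principal_polarization_def polarization_def)
  define c where "c = H (axis 1 1) (axis 1 1)"
  have "c = cnj c" using herm unfolding hermitian_form_def c_def by blast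
  then have c: "c = of_real (Re c)" by (simp add: complex_eq_iff)
  have "Re c > 0" unfolding c_def by (rule pos) (simp add: axis_eq_0_iff)
  define r where "r = Re c * sqrt 19 / 2"
  have r: "r > 0" using \<open>Re c > 0\<close> by (simp add: r_def)
  have Hr: "H u v = of_real r * theta u v" for u v
  proof -
    have "H u v = c * herm u v" unfolding c_def by (rule invariant_form_scalar[OF herm inv])
    also have "c = of_real r * (2 / sqrt 19)" by (subst c) (simp add: r_def)
    finally show ?thesis by (simp add: theta_def)
  qed
  have theta_scale: "theta (a *s u) v = a * theta u v" for a u v
    by (simp add: theta_def herm_scale_left)
  \<comment> \<open>Integrality of \<open>H\<close> places r \<open>wvec 0\<close> in the dual of
    the lattice for \<open>theta\<close>, which is the lattice itself.\<close>
  have "of_real r *s wvec 0 \<in> {u. \<forall>l\<in>lat. Im (theta u l) \<in> \<int>}"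
    using int[OF wvec_lat[of 0]] unfolding Hr by (simp add: theta_scale)
  then have "r \<in> \<int>" unfolding theta_dual by (rule real_multiple_wvec_lat)
  \<comment> \<open>The roles of \<open>H\<close> and \<open>theta\<close> are exchanged:
    \<open>wvec 0\<close> divided by r lies in the dual for \<open>H\<close>. A positive integer
    whose inverse is an integer is 1.\<close>
  have "H (of_real (1 / r) *s wvec 0) l = theta (wvec 0) l" for l
    using r by (simp add: Hr theta_scale)
  moreover have "wvec 0 \<in> {u. \<forall>l\<in>lat. Im (theta u l) \<in> \<int>}"
    unfolding theta_dual by (rule wvec_lat)
  ultimately have "of_real (1 / r) *s wvec 0 \<in> {u. \<forall>l\<in>lat. Im (H u l) \<in> \<int>}" by simp
  then have "1 / r \<in> \<int>" unfolding dual by (rule real_multiple_wvec_lat)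
  obtain m n :: int where m: "r = of_int m" and n: "1 / r = of_int n"
    using \<open>r \<in> \<int>\<close> \<open>1 / r \<in> \<int>\<close> by (auto elim!: Ints_cases)
  have "real_of_int m > 0" "real_of_int n > 0" using r m n by (metis, metis zero_less_divide_1_iff)
  then have "m \<ge> 1" "n \<ge> 1" by auto
  then have "r \<ge> 1" "1 / r \<ge> 1" using m n by auto
  then have "r = 1" using r by (simp add: field_simps)
  then show ?thesis by (intro ext) (simp add: Hr)
qed

text \<open>The standard basis is orthogonal for \<open>theta\<close> with common value 2/\<surd>19,
  so the double sum collapses to its diagonal and the factor \<i>/2 becomes \<i>/\<surd>19.\<close>

lemma first_chern_theta:
  "first_chern theta = (\<lambda>u v. \<i> / of_real (sqrt 19) * (\<Sum>k=1..9. wedge (dx k) (dxbar k) u v))"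
proof (intro ext)
  fix u v
  have t: "theta (ebasis j) (ebasis k) = (if k = j then 2 / sqrt 19 else 0)"
    if "j \<in> {1..9}" "k \<in> {1..9}" for j k
  proof -
    have "(of_nat k :: 9) = of_nat j \<longleftrightarrow> k = j"
      using bij_of_nat_1_9 that by (meson bij_betw_def inj_on_eq_iff)
    then show ?thesis
      by (simp add: theta_def herm_def ebasis_def axis_def if_distrib[of cnj] if_distrib[of "\<lambda>c. c * _"] eq_commute cong: if_cong)
  qed
  have "(\<Sum>j=1..9. \<Sum>k=1..9. theta (ebasis j) (ebasis k) * wedge (dx j) (dxbar k) u v)
      = (\<Sum>j=1..9. \<Sum>k=1..9. if k = j then 2 / sqrt 19 * wedge (dx j) (dxbar j) u v else 0)"
    by (intro sum.cong refl) (simp add: t)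
  also have "\<dots> = 2 / sqrt 19 * (\<Sum>j=1..9. wedge (dx j) (dxbar j) u v)"
    by (simp add: sum_distrib_left)
  finally show "first_chern theta u v = \<i> / of_real (sqrt 19) * (\<Sum>k=1..9. wedge (dx k) (dxbar k) u v)"
    by (simp add: first_chern_def)
qed

text \<open>This yields the directness of the sum over 4..8. The coefficients, extended by zero at
  0..3, form a vector that \<open>basis_map\<close> sends to 0, and \<open>basis_map\<close> is
  injective.\<close>

lemma vvec_independent:
  assumes "(\<Sum>k=4..8. a k *s vvec k) = 0" "k \<in> {4..8}"
  shows "a k = 0"
proof -
  have inj8: "inj_on (of_nat :: nat \<Rightarrow> 9) {0..<9}" using bij_of_nat_9[of 0] by (simp add: bij_betw_def)
  define z :: V where "z = (\<Sum>j=4..8. axis (of_nat j) (a j))"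
  have z: "z $ of_nat m = (if m \<in> {4..8} then a m else 0)" if "m \<le> 8" for m
  proof -
    have "z $ of_nat m = (\<Sum>j=4..8. if j = m then a m else 0)"
      unfolding z_def sum_component
    proof (rule sum.cong[OF refl])
      fix j assume "j \<in> {4..8::nat}"
      then have "(of_nat m :: 9) = of_nat j \<longleftrightarrow> m = j"
        using that by (intro inj_on_eq_iff[OF inj8]) auto
      then show "axis (of_nat j) (a j) $ (of_nat m :: 9) = (if j = m then a m else 0)"
        by (auto simp: axis_def)
    qed
    then show ?thesis by simp
  qed
  interpret L: Vector_Spaces.linear "(*s)" "(*s)" basis_map by (rule complex_linear_basis_map)
  have "basis_map z = 0 + (\<Sum>k=4..8. a k *s vvec k)"
    unfolding basis_map_def
    by (intro arg_cong2[of _ _ _ _ "(+)"] sum.neutral sum.cong) (auto simp: z)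
  then have "basis_map z = basis_map 0" using assms(1) by (simp add: L.zero)
  then have "z = 0" using injD[OF bij_is_inj[OF bij_basis_map]] by blast
  then show ?thesis using z[of k] assms(2) by simp
qed

theorem theorem1:
  shows "nu = (- 1 + \<i> * of_real (sqrt 19)) / 2 \<and>
    (\<exists>\<Lambda> :: V set.
       is_lattice \<Lambda> \<and>
       (\<exists>t. torus_automorphism \<Lambda> t \<and> analytic_representation \<Lambda> \<Lambda> t tau_map) \<and>
       (\<exists>s. torus_automorphism \<Lambda> s \<and> analytic_representation \<Lambda> \<Lambda> s sigma_map) \<and>
       (\<exists>h. torus_iso \<Lambda> (lattice_power (int_adjoin nu) :: (complex^9) set) h) \<and>
       (\<exists>!\<Theta>. principal_polarization \<Lambda> \<Theta> \<and>
          form_pullback sigma_map \<Theta> = \<Theta> \<and> form_pullback tau_map \<Theta> = \<Theta>) \<and>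
       \<Lambda> = {(\<Sum>k=0..3. a k *s wvec k) + (\<Sum>k=4..8. a k *s vvec k) | a.
             \<forall>k\<in>{0..8}. a k \<in> int_adjoin nu} \<and>
       (\<forall>a. (\<forall>k\<in>{4..8}. a k \<in> int_adjoin nu) \<and> (\<Sum>k=4..8. a k *s vvec k) = 0 \<longrightarrow>
          (\<forall>k\<in>{4..8}. a k = 0)) \<and>
       (\<forall>\<Theta>. principal_polarization \<Lambda> \<Theta> \<and>
          form_pullback sigma_map \<Theta> = \<Theta> \<and> form_pullback tau_map \<Theta> = \<Theta> \<longrightarrow>
          first_chern \<Theta> =
            (\<lambda>u v. \<i> / of_real (sqrt 19) * (\<Sum>k=1..9. wedge (dx k) (dxbar k) u v))))"
proof (intro conjI exI[of _ lat])
  have im: "basis_map ` lattice_power (int_adjoin nu) = lat"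
    by (simp only: lat_eq_basis_span basis_span_eq_image)
  show "nu = (- 1 + \<i> * of_real (sqrt 19)) / 2" by (rule nu_value)
  have "is_lattice (lattice_power (int_adjoin nu) :: V set)"
    unfolding int_adjoin_nu using Im_nu_pos by (intro is_lattice_lattice_power) simp
  then show "is_lattice lat"
    unfolding im[symmetric]
    by (rule is_lattice_linear_image[OF _ bounded_linear.linear[OF complex_linear_bounded_linear[OF
            complex_linear_basis_map]] bij_basis_map])
  show "\<exists>t. torus_automorphism lat t \<and> analytic_representation lat lat t tau_map"
    using torus_iso_linear[OF complex_linear_tau finite_order_preserves(1)[OF tau_map_order lat_tau]
        add_subgroup_lat finite_order_preserves(2)[OF tau_map_order lat_tau]] by blast
  show "\<exists>s. torus_automorphism lat s \<and> analytic_representation lat lat s sigma_map"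
    using torus_iso_linear[OF complex_linear_sigma finite_order_preserves(1)[OF sigma_map_order lat_sigma]
        add_subgroup_lat finite_order_preserves(2)[OF sigma_map_order lat_sigma]] by blast
  \<comment> \<open>The required isomorphism starts at the torus of \<open>lat\<close>, so it is
    induced by the inverse of \<open>basis_map\<close>.\<close>
  have "inv_into UNIV basis_map ` lat = lattice_power (int_adjoin nu)"
    unfolding im[symmetric] using bij_basis_map by (simp add: bij_def image_inv_f_f)
  then show "\<exists>h. torus_iso lat (lattice_power (int_adjoin nu) :: (complex^9) set) h"
    using torus_iso_linear(1)[OF complex_linear_inv[OF complex_linear_basis_map bij_basis_map]
        bij_imp_bij_inv[OF bij_basis_map] add_subgroup_lat] by blast
  show "\<exists>!\<Theta>. principal_polarization lat \<Theta> \<and>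
      form_pullback sigma_map \<Theta> = \<Theta> \<and> form_pullback tau_map \<Theta> = \<Theta>"
    using theta_principal theta_invariant invariant_principal_unique by blast
  show "lat = {(\<Sum>k=0..3. a k *s wvec k) + (\<Sum>k=4..8. a k *s vvec k) | a.
      \<forall>k\<in>{0..8}. a k \<in> int_adjoin nu}"
    by (simp only: lat_eq_basis_span basis_span_def)
  show "\<forall>a. (\<forall>k\<in>{4..8}. a k \<in> int_adjoin nu) \<and> (\<Sum>k=4..8. a k *s vvec k) = 0 \<longrightarrow>
      (\<forall>k\<in>{4..8}. a k = 0)"
    using vvec_independent by blast
  show "\<forall>\<Theta>. principal_polarization lat \<Theta> \<and>
      form_pullback sigma_map \<Theta> = \<Theta> \<and> form_pullback tau_map \<Theta> = \<Theta> \<longrightarrow>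
      first_chern \<Theta> =
        (\<lambda>u v. \<i> / of_real (sqrt 19) * (\<Sum>k=1..9. wedge (dx k) (dxbar k) u v))"
    using invariant_principal_unique first_chern_theta by blast
qed

end
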